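(* Let $\tau$ vary in the upper half plane, set $\omega_1=1/2$, $\omega_3=\tau/2$, $\omega_2=-\omega_1-\omega_3$, let $e_i=\wp(\omega_i)$ $(i=1,2,3)$ and $\eta_1=\zeta(\omega_1)$ be formed from the Weierstrass functions with periods $(2\omega_1,2\omega_3)=(1,\tau)$, and set $t=(e_3-e_1)/(e_2-e_1)$. Then, as functions of $\tau$, $$\frac{dt}{d\tau}=\frac{(e_2-e_1)\,t(t-1)}{\pi\sqrt{-1}},$$ $$\frac{d}{d\tau}\left(\frac{1}{(e_2-e_1)^{1/2}}\right)=\frac{\eta_1+e_3/2}{\pi\sqrt{-1}\,(e_2-e_1)^{1/2}},$$ and, for every constant $\alpha\in\mathbb{C}$, $$\frac{d}{d\tau}\left((e_2-e_1)^{\alpha}\right)=-\frac{\alpha\,(2\eta_1+e_3)\,(e_2-e_1)^{\alpha}}{\pi\sqrt{-1}}.$$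
   Context: For $\tau$ in the upper half plane, $\wp$ and $\zeta$ denote the Weierstrass $\wp$-function and Weierstrass zeta function of the lattice $\mathbb{Z}\oplus\tau\mathbb{Z}$ (with $\zeta'=-\wp$, $\zeta$ odd). Thus $e_1=\wp(1/2)$, $e_2=\wp((1+\tau)/2)$, $e_3=\wp(\tau/2)$ and $\eta_1=\zeta(1/2)$, all regarded as holomorphic functions of $\tau$. The function $e_2-e_1$ has no zeros on the upper half plane, and powers $(e_2-e_1)^{1/2}$, $(e_2-e_1)^{\alpha}$ denote any fixed holomorphic branch in $\tau$ (that is, $\exp(\alpha L(\tau))$ for a holomorphic logarithm $L$ of $e_2-e_1$). *)

theory Defs
  imports "HOL-Analysis.Analysis"
begin

definition upper_half_plane :: "complex set" where
  "upper_half_plane = {\<tau>. Im \<tau> > 0}"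

definition period_lattice :: "complex \<Rightarrow> complex set" where
  "period_lattice \<tau> = {of_int m + of_int n * \<tau> | m n :: int. True}"

(* For \<tau> in the upper half plane and z outside the lattice, both series below converge absolutely,
   so the unordered sums over the lattice are genuine ones. *)

definition weierstrass_wp :: "complex \<Rightarrow> complex \<Rightarrow> complex" where
  "weierstrass_wp \<tau> z =
     1 / z ^ 2 + (\<Sum>\<^sub>\<infinity>\<omega> \<in> period_lattice \<tau> - {0}. 1 / (z - \<omega>) ^ 2 - 1 / \<omega> ^ 2)"

definition weierstrass_zeta :: "complex \<Rightarrow> complex \<Rightarrow> complex" where
  "weierstrass_zeta \<tau> z =
     1 / z + (\<Sum>\<^sub>\<infinity>\<omega> \<in> period_lattice \<tau> - {0}. 1 / (z - \<omega>) + 1 / \<omega> + z / \<omega> ^ 2)"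

definition half_period1 :: "complex \<Rightarrow> complex" where
  "half_period1 \<tau> = 1 / 2"

definition half_period3 :: "complex \<Rightarrow> complex" where
  "half_period3 \<tau> = \<tau> / 2"

(* The three half-periods sum to zero; as the Weierstrass p-function is even, its value here
   is also its value at (1 + \<tau>) / 2. *)
definition half_period2 :: "complex \<Rightarrow> complex" where
  "half_period2 \<tau> = - half_period1 \<tau> - half_period3 \<tau>"

definition e1 :: "complex \<Rightarrow> complex" where
  "e1 \<tau> = weierstrass_wp \<tau> (half_period1 \<tau>)"

definition e2 :: "complex \<Rightarrow> complex" where
  "e2 \<tau> = weierstrass_wp \<tau> (half_period2 \<tau>)"

definition e3 :: "complex \<Rightarrow> complex" where
  "e3 \<tau> = weierstrass_wp \<tau> (half_period3 \<tau>)"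

definition eta1 :: "complex \<Rightarrow> complex" where
  "eta1 \<tau> = weierstrass_zeta \<tau> (half_period1 \<tau>)"

definition t_fun :: "complex \<Rightarrow> complex" where
  "t_fun \<tau> = (e3 \<tau> - e1 \<tau>) / (e2 \<tau> - e1 \<tau>)"

definition holomorphic_log_on :: "(complex \<Rightarrow> complex) \<Rightarrow> (complex \<Rightarrow> complex) \<Rightarrow> complex set \<Rightarrow> bool" where
  "holomorphic_log_on L f A \<longleftrightarrow> L holomorphic_on A \<and> (\<forall>\<tau>\<in>A. exp (L \<tau>) = f \<tau>)"

(* The power f^a determined by the holomorphic logarithm L of f.  The library's powr on the complex
   numbers uses the principal logarithm, which need not give a continuous branch in \<tau>. *)
definition branch_power :: "(complex \<Rightarrow> complex) \<Rightarrow> complex \<Rightarrow> complex \<Rightarrow> complex" where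
  "branch_power L a \<tau> = exp (a * L \<tau>)"

end

(* Summing over rows of the lattice turns e_i + 2 eta_1 into the exponentially convergent series
   A_i = sum_n (pi / sin (pi (w_i + n tau)))^2.  For u + v + w = 0 the addition theorem of the
   cotangent gives, with s = pi / sin (pi .) and c = pi cot (pi .),
     s(u)^2 s(v)^2 = s(w)^2 s(u)^2 + s(w)^2 s(v)^2 + 2 c(w) s(w) s(u) s(v),
     s(u) s(v) = - s(w) (c(u) + c(v)).
   Summing the first identity over u = w_1 + n tau, v = w_2 + m tau, w = w_3 + k tau with
   n + m + k = 0, for each fixed k the last term sums to -2 c(w) s(w)^2 (T_0 + 2 pi i k), because the
   sum of c(u) + c(v) jumps by 2 pi i (the difference of the limits of c at -i infinity and
   +i infinity) when k increases by 1.  As sum_k c(w) s(w)^2 = 0 by oddness, what remains is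
   2 pi i dA_3/dtau, and one obtains the Halphen system
     2 pi i A_3' = A_1 A_2 - A_3 (A_1 + A_2)   and its permutations,
   whence pi i (A_2 - A_1)' = - A_3 (A_2 - A_1) and pi i (A_3 - A_1)' = - A_2 (A_3 - A_1).  The first of
   these linear equations also shows that A_2 - A_1 has no zeros unless it vanishes identically, and
   at tau = 1 + i the numbers A_1 > 0 > A_2 are different. *)

theory Submission
  imports Defs "HOL-Complex_Analysis.Complex_Analysis"
begin

section \<open>Sums over the integers\<close>

text \<open>Convergence of partial sums alone would not give an unordered sum. Once summability is
  known, the value can be read off along the intervals from -N to N - 1, which are cofinal among the
  finite sets and over which the sum telescopes. The two ends may have different limits; this
  produces the jump by 2 pi i later.\<close>

lemma has_sum_int_telescope:
  fixes g :: "int \<Rightarrow> 'a :: {real_normed_vector, t2_space}"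
  assumes summable: "(\<lambda>n. g (n + 1) - g n) summable_on UNIV"
    and lim_top: "(\<lambda>N. g (int N)) \<longlonglongrightarrow> a"
    and lim_bot: "(\<lambda>N. g (- int N)) \<longlonglongrightarrow> b"
  shows "((\<lambda>n. g (n + 1) - g n) has_sum (a - b)) UNIV"
proof -
  define d where "d = (\<lambda>n. g (n + 1) - g n)"
  from summable have S: "(d has_sum infsum d UNIV) UNIV"
    by (simp add: d_def)
  have "filterlim (\<lambda>N. {- int N..<int N}) (finite_subsets_at_top UNIV) sequentially"
    unfolding filterlim_finite_subsets_at_top
  proof (intro allI impI)
    fix X :: "int set" assume "finite X \<and> X \<subseteq> UNIV"
    then have M: "\<bar>x\<bar> \<le> Max (abs ` X)" if "x \<in> X" for x
      using that by simp
    have "X \<subseteq> {- int N..<int N}" if "N > nat (Max (abs ` X))" for N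
    proof
      fix x assume "x \<in> X"
      from M[OF this] that show "x \<in> {- int N..<int N}" by simp linarith
    qed
    then show "\<forall>\<^sub>F N in sequentially. finite {- int N..<int N} \<and>
        X \<subseteq> {- int N..<int N} \<and> {- int N..<int N} \<subseteq> UNIV"
      by (auto intro!: eventually_mono[OF eventually_gt_at_top[of "nat (Max (abs ` X))"]])
  qed
  with S have lim: "(\<lambda>N. sum d {- int N..<int N}) \<longlonglongrightarrow> infsum d UNIV"
    unfolding has_sum_def by (rule filterlim_compose)
  have "sum d {- int N..<int N} = g (int N) - g (- int N)" for N
  proof (induction N)
    case (Suc N)
    \<comment> \<open>The half-open interval grows by one point at either end: N and -N-1.\<close>
    have "{- int (Suc N)..<int (Suc N)} = insert (int N) (insert (- 1 - int N) {- int N..<int N})"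
      by auto
    with Suc show ?case by (simp add: d_def add.commute)
  qed simp
  with lim have "(\<lambda>N. g (int N) - g (- int N)) \<longlonglongrightarrow> infsum d UNIV" by simp
  moreover have "(\<lambda>N. g (int N) - g (- int N)) \<longlonglongrightarrow> a - b"
    by (intro tendsto_diff lim_top lim_bot)
  ultimately have "infsum d UNIV = a - b" by (rule LIMSEQ_unique)
  with S show ?thesis by (simp add: d_def)
qed

lemma has_sum_diff:
  fixes f g :: "'a \<Rightarrow> complex"
  assumes "(f has_sum a) A" "(g has_sum b) A"
  shows "((\<lambda>x. f x - g x) has_sum (a - b)) A"
  using has_sum_add[OF assms(1) has_sum_uminusI[OF assms(2)]] by simp

text \<open>The negative integers are indexed as -n-1, so that 0 is counted only once.\<close>

lemma has_sum_int_split: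
  fixes f :: "int \<Rightarrow> 'a :: real_normed_vector"
  assumes "((\<lambda>n. f (int n)) has_sum a) UNIV" "((\<lambda>n. f (- int n - 1)) has_sum b) UNIV"
  shows "(f has_sum (a + b)) UNIV"
proof -
  have "bij_betw int UNIV {0..}"
    by (rule bij_betwI[of _ _ _ nat]) auto
  then have "(f has_sum a) {0..}"
    using assms(1) has_sum_reindex_bij_betw[where f = f and S = a] by blast
  moreover have "bij_betw (\<lambda>n. - int n - 1) UNIV {..<0}"
    by (rule bij_betwI[of _ _ _ "\<lambda>n. nat (- n - 1)"]) auto
  then have "(f has_sum b) {..<0}"
    using assms(2) has_sum_reindex_bij_betw[where f = f and S = b] by blast
  ultimately have "(f has_sum (a + b)) ({0..} \<union> {..<0})"
    by (rule has_sum_Un_disjoint) auto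
  also have "{0..} \<union> {..<0} = (UNIV :: int set)" by auto
  finally show ?thesis .
qed

lemma summable_on_int_split:
  fixes f :: "int \<Rightarrow> 'a :: real_normed_vector"
  assumes "(\<lambda>n. f (int n)) summable_on UNIV" "(\<lambda>n. f (- int n - 1)) summable_on UNIV"
  shows "f summable_on UNIV"
  using assms has_sum_int_split unfolding summable_on_def by blast

lemma summable_on_int_power_abs:
  fixes r :: real
  assumes "0 \<le> r" "r < 1"
  shows "(\<lambda>n::int. r ^ nat \<bar>n\<bar>) summable_on UNIV"
proof (rule summable_on_int_split)
  show "(\<lambda>n. r ^ nat \<bar>int n\<bar>) summable_on UNIV"
    using assms by (auto intro!: summable_nonneg_imp_summable_on summable_geometric)
  have "nat \<bar>- int n - 1\<bar> = Suc n" for n by simp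
  then show "(\<lambda>n. r ^ nat \<bar>- int n - 1\<bar>) summable_on UNIV"
    using assms
    by (auto intro!: summable_nonneg_imp_summable_on summable_mult summable_geometric)
qed

text \<open>Absolute summability of both factors makes the double family summable over the pairs, so
  that it may later be rearranged by bijections of the index pairs and summed row by row.\<close>

lemma has_sum_product:
  fixes f :: "'a \<Rightarrow> complex" and g :: "'b \<Rightarrow> complex"
  assumes f: "(\<lambda>x. norm (f x)) summable_on A" and g: "(\<lambda>y. norm (g y)) summable_on B"
  shows "((\<lambda>(x, y). f x * g y) has_sum (infsum f A * infsum g B)) (A \<times> B)"
proof (rule has_sum_SigmaI)
  show "((\<lambda>y. case (x, y) of (x, y) \<Rightarrow> f x * g y) has_sum (f x * infsum g B)) B" for x
    using has_sum_cmult_right[OF has_sum_infsum[OF abs_summable_summable[OF g]]] by simp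
  show "((\<lambda>x. f x * infsum g B) has_sum (infsum f A * infsum g B)) A"
    by (rule has_sum_cmult_left[OF has_sum_infsum[OF abs_summable_summable[OF f]]])
  have "(\<lambda>(x, y). norm (f x) * norm (g y)) summable_on A \<times> B"
  proof (rule summable_on_SigmaI)
    show "((\<lambda>y. case (x, y) of (x, y) \<Rightarrow> norm (f x) * norm (g y)) has_sum
        (norm (f x) * infsum (\<lambda>y. norm (g y)) B)) B" for x
      using has_sum_cmult_right[OF has_sum_infsum[OF g]] by simp
    show "(\<lambda>x. norm (f x) * infsum (\<lambda>y. norm (g y)) B) summable_on A"
      by (rule summable_on_cmult_left[OF f])
  qed auto
  then have "(\<lambda>z. norm (case z of (x, y) \<Rightarrow> f x * g y)) summable_on A \<times> B"
    by (simp add: case_prod_unfold norm_mult)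
  then show "(\<lambda>(x, y). f x * g y) summable_on A \<times> B"
    by (rule abs_summable_summable)
qed

section \<open>Partial fractions and the addition theorem\<close>

lemma one_minus_notin_Ints: "z \<notin> \<int> \<Longrightarrow> 1 - z \<notin> (\<int> :: complex set)"
  by (metis Ints_1 Ints_diff diff_diff_eq2 add_diff_cancel_left')

lemma sin_pi_times_neq_0:
  fixes z :: complex
  assumes "z \<notin> \<int>"
  shows "sin (of_real pi * z) \<noteq> 0"
proof
  assume "sin (of_real pi * z) = 0"
  then obtain n :: int where "of_real pi * z = of_real (of_int n * pi)"
    by (auto simp: sin_eq_0)
  then have "z = of_int n" by simp
  with assms show False by simp
qed

text \<open>Differentiate the reflection formula \<open>rGamma z * rGamma (1 - z)\<close> = sin (pi
  z) / pi on both sides.\<close>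

lemma Digamma_reflection_complex:
  fixes z :: complex
  assumes z: "z \<notin> \<int>"
  shows "(Digamma (1 - z) - Digamma z) * sin (of_real pi * z) = of_real pi * cos (of_real pi * z)"
proof -
  from z have "z \<notin> \<int>\<^sub>\<le>\<^sub>0" "1 - z \<notin> \<int>\<^sub>\<le>\<^sub>0"
    using one_minus_notin_Ints[OF z] by auto
  then have "((\<lambda>z. rGamma z * rGamma (1 - z)) has_field_derivative
      rGamma z * rGamma (1 - z) * (Digamma (1 - z) - Digamma z)) (at z)"
    by (auto intro!: derivative_eq_intros simp: algebra_simps)
  moreover have "((\<lambda>z. rGamma z * rGamma (1 - z)) has_field_derivative cos (of_real pi * z)) (at z)"
    unfolding rGamma_reflection_complex by (auto intro!: derivative_eq_intros)
  ultimately have "rGamma z * rGamma (1 - z) * (Digamma (1 - z) - Digamma z) = cos (of_real pi * z)"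
    by (rule DERIV_unique)
  then show ?thesis by (simp add: rGamma_reflection_complex field_simps)
qed

text \<open>One more differentiation, now of the Digamma reflection formula, which holds on the open
  complement of the integers.\<close>

lemma Polygamma_1_reflection_complex:
  fixes z :: complex
  assumes z: "z \<notin> \<int>"
  shows "Polygamma 1 z + Polygamma 1 (1 - z) = (of_real pi / sin (of_real pi * z)) ^ 2"
proof -
  have nz: "z \<notin> \<int>\<^sub>\<le>\<^sub>0" "1 - z \<notin> \<int>\<^sub>\<le>\<^sub>0" using z one_minus_notin_Ints[OF z] by auto
  let ?s = "sin (of_real pi * z)" and ?c = "cos (of_real pi * z)"
  have s: "?s \<noteq> 0" using z by (rule sin_pi_times_neq_0)
  have "((\<lambda>z. Digamma (1 - z) - Digamma z) has_field_derivative
      - Polygamma 1 (1 - z) - Polygamma 1 z) (at z)"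
    using nz by (auto intro!: derivative_eq_intros DERIV_chain2[OF has_field_derivative_Polygamma])
  moreover have "((\<lambda>z. of_real pi * cos (of_real pi * z) / sin (of_real pi * z)) has_field_derivative
      - ((of_real pi / ?s) ^ 2)) (at z)"
  proof -
    have "((\<lambda>z. of_real pi * cos (of_real pi * z)) has_field_derivative
        - (of_real pi * ?s * of_real pi)) (at z)"
      "((\<lambda>z. sin (of_real pi * z)) has_field_derivative of_real pi * ?c) (at z)"
      by (auto intro!: derivative_eq_intros)
    from DERIV_divide[OF this s]
    have "((\<lambda>z. of_real pi * cos (of_real pi * z) / sin (of_real pi * z)) has_field_derivative
      (- (of_real pi * ?s * of_real pi) * ?s - of_real pi * ?c * (of_real pi * ?c)) / (?s * ?s)) (at z)" .
    also have "- (of_real pi * ?s * of_real pi) * ?s - of_real pi * ?c * (of_real pi * ?c) =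
        - (of_real pi ^ 2 * (?s ^ 2 + ?c ^ 2))"
      by algebra
    also have "?s ^ 2 + ?c ^ 2 = 1" by simp
    finally show ?thesis by (simp add: power2_eq_square)
  qed
  then have "((\<lambda>z. Digamma (1 - z) - Digamma z) has_field_derivative
      - ((of_real pi / ?s) ^ 2)) (at z)"
  proof (rule has_field_derivative_transform_within_open)
    show "open (- \<int> :: complex set)" by (simp add: open_Compl closed_Ints)
    show "of_real pi * cos (of_real pi * w) / sin (of_real pi * w) = Digamma (1 - w) - Digamma w"
      if "w \<in> - \<int>" for w :: complex
      using that Digamma_reflection_complex[of w] sin_pi_times_neq_0[of w] by (simp add: field_simps)
  qed (use z in auto)
  ultimately have "- Polygamma 1 (1 - z) - Polygamma 1 z = - ((of_real pi / ?s) ^ 2)"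
    by (rule DERIV_unique)
  then show ?thesis by (simp add: algebra_simps)
qed

lemma has_sum_Polygamma_1:
  fixes z :: complex
  assumes "z \<noteq> 0"
  shows "((\<lambda>n. 1 / (z + of_nat n) ^ 2) has_sum Polygamma 1 z) UNIV"
proof (rule norm_summable_imp_has_sum)
  show "(\<lambda>n. 1 / (z + of_nat n) ^ 2) sums Polygamma 1 z"
    using Polygamma_LIMSEQ[OF assms, of 1] by (simp add: inverse_eq_divide power2_eq_square)
  show "summable (\<lambda>n. norm (1 / (z + of_nat n) ^ 2))"
  proof (rule summable_comparison_test_ev)
    \<comment> \<open>The factor 4 comes from |z + n| >= n / 2, valid once n >= 2 |z|.\<close>
    show "summable (\<lambda>n. 4 * inverse (real n ^ 2))"
      by (intro summable_mult inverse_power_summable) auto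
    obtain N :: nat where N: "2 * norm z < N" using reals_Archimedean2 by blast
    have "norm (1 / (z + of_nat n) ^ 2) \<le> 4 * inverse (real n ^ 2)" if "n \<ge> N" "n > 0" for n
    proof -
      have "norm (of_nat n :: complex) - norm z \<le> norm (z + of_nat n)"
        by (metis add.commute norm_diff_ineq)
      with N that have "real n / 2 \<le> norm (z + of_nat n)" by simp
      then have "(real n / 2) ^ 2 \<le> norm (z + of_nat n) ^ 2"
        by (intro power_mono) auto
      then have "inverse (norm (z + of_nat n) ^ 2) \<le> inverse ((real n / 2) ^ 2)"
        using that by (intro le_imp_inverse_le) auto
      then show ?thesis by (simp add: norm_divide norm_power field_simps)
    qed
    then show "\<forall>\<^sub>F n in sequentially. norm (norm (1 / (z + of_nat n) ^ 2)) \<le> 4 * inverse (real n ^ 2)"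
      by (auto intro!: eventually_sequentiallyI[of "Suc N"])
  qed
qed

text \<open>The partial fraction expansion: the terms with n >= 0 give the trigamma function at z,
  those with n < 0 give it at 1 - z, and the reflection formula adds the two.\<close>

lemma has_sum_csc_squared:
  fixes z :: complex
  assumes z: "z \<notin> \<int>"
  shows "((\<lambda>n::int. 1 / (z + of_int n) ^ 2) has_sum (of_real pi / sin (of_real pi * z)) ^ 2) UNIV"
  unfolding Polygamma_1_reflection_complex[OF z, symmetric]
proof (rule has_sum_int_split)
  show "((\<lambda>n. 1 / (z + of_int (int n)) ^ 2) has_sum Polygamma 1 z) UNIV"
    using has_sum_Polygamma_1[of z] z by (cases "z = 0") auto
  have "(z + of_int (- int n - 1)) ^ 2 = (1 - z + of_nat n) ^ 2" for n
    by (simp add: power2_eq_square algebra_simps)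
  then show "((\<lambda>n. 1 / (z + of_int (- int n - 1)) ^ 2) has_sum Polygamma 1 (1 - z)) UNIV"
    using has_sum_Polygamma_1[of "1 - z"] z by (cases "z = 1") auto
qed

section \<open>Cosecant and cotangent scaled by pi\<close>

definition csc :: "complex \<Rightarrow> complex" where
  "csc w = of_real pi / sin (of_real pi * w)"

text \<open>With the factor pi this is the logarithmic derivative of sin (pi w), and the derivative
  of \<open>csc\<close> is \<open>- (ctn w * csc w)\<close> without further constants.\<close>

definition ctn :: "complex \<Rightarrow> complex" where
  "ctn w = of_real pi * cos (of_real pi * w) / sin (of_real pi * w)"

lemma csc_minus: "csc (- w) = - csc w"
  by (simp add: csc_def)

lemma ctn_minus: "ctn (- w) = - ctn w"
  by (simp add: ctn_def)

text \<open>The cosecant itself changes sign under a shift by 1, so only its square is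
  periodic.\<close>

lemma
  shows csc_squared_plus_int: "csc (w + of_int k) ^ 2 = csc w ^ 2"
    and ctn_plus_int: "ctn (w + of_int k) = ctn w"
proof -
  have s: "sin (of_real pi * of_int k :: complex) = 0"
    unfolding sin_eq_0 by (intro exI[of _ k]) simp
  have c: "cos (of_real pi * of_int k :: complex) ^ 2 = 1"
    using sin_cos_squared_add[of "of_real pi * of_int k :: complex"] s by simp
  then have c0: "cos (of_real pi * of_int k :: complex) \<noteq> 0" by auto
  show "csc (w + of_int k) ^ 2 = csc w ^ 2"
    by (simp add: csc_def distrib_left sin_add s c power_divide power_mult_distrib)
  show "ctn (w + of_int k) = ctn w"
    using c0 by (simp add: ctn_def distrib_left sin_add cos_add s)
qed

lemma ctn_squared:
  assumes "sin (of_real pi * w) \<noteq> 0"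
  shows "ctn w ^ 2 = csc w ^ 2 - of_real pi ^ 2"
proof -
  have "ctn w ^ 2 = of_real pi ^ 2 * (1 - sin (of_real pi * w) ^ 2) / sin (of_real pi * w) ^ 2"
    by (simp add: ctn_def power_divide power_mult_distrib cos_squared_eq)
  with assms show ?thesis by (simp add: csc_def power_divide field_simps)
qed

lemma csc_eq_0_iff: "csc w = 0 \<longleftrightarrow> sin (of_real pi * w) = 0"
  by (simp add: csc_def)

text \<open>Over the common denominator the numerator of \<open>ctn u + ctn v\<close> is pi sin (pi
  (u + v)), which equals - pi sin (pi w).\<close>

lemma ctn_add_ctn:
  assumes "u + v + w = 0"
    and "sin (of_real pi * u) \<noteq> 0" "sin (of_real pi * v) \<noteq> 0" "sin (of_real pi * w) \<noteq> 0"
  shows "csc u * csc v = - csc w * (ctn u + ctn v)"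
proof -
  have w: "w = - (u + v)" using assms(1) by algebra
  have sum: "sin (of_real pi * u) * cos (of_real pi * v) + cos (of_real pi * u) * sin (of_real pi * v)
      = - sin (of_real pi * w)"
    unfolding w by (simp only: mult_minus_right sin_minus distrib_left sin_add) simp
  have "ctn u + ctn v = of_real pi * (sin (of_real pi * u) * cos (of_real pi * v)
      + cos (of_real pi * u) * sin (of_real pi * v)) / (sin (of_real pi * u) * sin (of_real pi * v))"
    using assms by (simp add: ctn_def field_simps)
  then show ?thesis
    unfolding sum using assms by (simp add: csc_def)
qed

text \<open>Rewriting \<open>csc w * csc u\<close> and \<open>csc w * csc v\<close> by permuted
  forms of \<open>ctn_add_ctn\<close> produces two terms with \<open>ctn w\<close>, which cancel
  against the last summand. The rest is \<open>ctn_add_ctn\<close> itself, multiplied by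
  \<open>csc u * csc v\<close>.\<close>

lemma csc_squared_mult_csc_squared:
  assumes "u + v + w = 0"
    and "sin (of_real pi * u) \<noteq> 0" "sin (of_real pi * v) \<noteq> 0" "sin (of_real pi * w) \<noteq> 0"
  shows "csc u ^ 2 * csc v ^ 2 =
    csc w ^ 2 * csc u ^ 2 + csc w ^ 2 * csc v ^ 2 + 2 * ctn w * csc w * (csc u * csc v)"
proof -
  define p q where "p = csc u" and "q = csc v"
  have 1: "csc w * ctn u + csc w * ctn v = - (p * q)"
    using ctn_add_ctn[OF assms] unfolding p_def q_def by algebra
  have "u + w + v = 0" "v + w + u = 0" using assms(1) by (simp_all add: add_ac)
  from ctn_add_ctn[OF this(1)] ctn_add_ctn[OF this(2)] assms
  have 2: "p * csc w = - q * (ctn u + ctn w)" "q * csc w = - p * (ctn v + ctn w)"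
    by (simp_all add: p_def q_def)
  have "csc w ^ 2 * p ^ 2 + csc w ^ 2 * q ^ 2 + 2 * ctn w * csc w * (p * q)
      = csc w * p * (p * csc w) + csc w * q * (q * csc w) + 2 * ctn w * csc w * (p * q)"
    by (simp add: power2_eq_square algebra_simps)
  also have "\<dots> = - (p * q) * (csc w * ctn u + csc w * ctn v)"
    unfolding 2 by (simp add: algebra_simps)
  also have "\<dots> = p ^ 2 * q ^ 2"
    unfolding 1 by (simp add: power2_eq_square algebra_simps)
  finally show ?thesis by (simp add: p_def q_def)
qed

text \<open>With y = pi |Im w| one has 2 |sin (pi w)| >= exp y - exp (-y). The distance d from the
  real axis bounds this below by a fixed multiple of exp y.\<close>

lemma norm_csc_le:
  assumes d: "0 < d" "d \<le> \<bar>Im w\<bar>"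
  shows "norm (csc w) \<le> 2 * pi / (1 - exp (- (2 * pi * d))) * exp (- (pi * \<bar>Im w\<bar>))"
proof -
  define y where "y = pi * \<bar>Im w\<bar>"
  have y: "pi * d \<le> y" using d by (simp add: y_def)
  have E: "exp (- (2 * pi * d)) < 1" using d by simp
  have "exp y * (1 - exp (- (2 * pi * d))) \<le> exp y * (1 - exp (- (2 * y)))"
    using y by (intro mult_left_mono) auto
  also have "\<dots> = exp y - exp (- y)"
    by (simp add: algebra_simps flip: exp_add)
  also have "\<dots> \<le> \<bar>exp (- (pi * Im w)) - exp (pi * Im w)\<bar>"
    by (cases "Im w \<ge> 0") (simp_all add: y_def abs_if)
  also have "\<dots> \<le> norm (exp (\<i> * (of_real pi * w)) - exp (- (\<i> * (of_real pi * w))))"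
    using norm_triangle_ineq3[of "exp (\<i> * (of_real pi * w))" "exp (- (\<i> * (of_real pi * w)))"]
    by simp
  also have "\<dots> = 2 * norm (sin (of_real pi * w))"
    by (simp add: sin_exp_eq norm_divide norm_mult)
  finally have *: "exp y * (1 - exp (- (2 * pi * d))) / 2 \<le> norm (sin (of_real pi * w))" by simp
  have pos: "0 < exp y * (1 - exp (- (2 * pi * d))) / 2" using E by simp
  have "norm (csc w) = pi / norm (sin (of_real pi * w))"
    by (simp add: csc_def norm_divide)
  also have "\<dots> \<le> pi / (exp y * (1 - exp (- (2 * pi * d))) / 2)"
    using * pos by (intro divide_left_mono mult_pos_pos) auto
  also have "\<dots> = 2 * pi / (1 - exp (- (2 * pi * d))) * exp (- y)"
    using E by (simp add: exp_minus field_simps)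
  finally show ?thesis by (simp add: y_def)
qed

text \<open>These measure how fast the cotangent approaches its limits -pi i and pi i far above and
  below the real axis: the exponential has norm at most 1 in the upper, respectively lower, half
  plane, so the error is at most the norm of \<open>csc w\<close>.\<close>

lemma
  assumes "sin (of_real pi * w) \<noteq> 0"
  shows ctn_plus_pi_i: "ctn w + of_real pi * \<i> = csc w * exp (\<i> * (of_real pi * w))"
    and ctn_minus_pi_i: "ctn w - of_real pi * \<i> = csc w * exp (- (\<i> * (of_real pi * w)))"
proof -
  let ?z = "of_real pi * w"
  have E: "exp (- (\<i> * ?z)) = cos ?z - \<i> * sin ?z"
    using exp_Euler[of "- ?z"] by simp
  with assms show "ctn w + of_real pi * \<i> = csc w * exp (\<i> * ?z)"
      "ctn w - of_real pi * \<i> = csc w * exp (- (\<i> * ?z))"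
    unfolding ctn_def csc_def E unfolding exp_Euler by (simp_all add: field_simps)
qed

section \<open>The Halphen system\<close>

text \<open>The point is (p + q tau) / 2 + n tau. Integers p and q, rather than a half-period class,
  are kept so that three such points have sum 0 exactly, and not only modulo the lattice, when their
  parameters do.\<close>

definition half_lattice_point :: "int \<Rightarrow> int \<Rightarrow> complex \<Rightarrow> int \<Rightarrow> complex" where
  "half_lattice_point p q \<tau> n = (of_int p + of_int (2 * n + q) * \<tau>) / 2"

definition csc_series :: "int \<Rightarrow> int \<Rightarrow> complex \<Rightarrow> complex" where
  "csc_series p q \<tau> = (\<Sum>\<^sub>\<infinity>n. csc (half_lattice_point p q \<tau> n) ^ 2)"

text \<open>A real point has 2n + q = 0, so q is even; integrality of the remaining p / 2 then makes
  p even as well.\<close>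

lemma half_lattice_point_notin_Ints:
  assumes "Im \<tau> > 0" "odd p \<or> odd q"
  shows "half_lattice_point p q \<tau> n \<notin> \<int>"
proof
  assume "half_lattice_point p q \<tau> n \<in> \<int>"
  then obtain k where k: "half_lattice_point p q \<tau> n = of_int k" by (elim Ints_cases)
  then have "of_int (2 * n + q) * Im \<tau> = 0"
    by (auto simp: half_lattice_point_def complex_eq_iff)
  with assms(1) have 0: "2 * n + q = 0" by (metis mult_eq_0_iff of_int_eq_0_iff less_irrefl)
  then have "even q" by presburger
  from k have "of_int p / 2 = (of_int k :: complex)" unfolding half_lattice_point_def 0 by simp
  then have "of_int p = (of_int (2 * k) :: complex)" by simp
  then have "p = 2 * k" by (simp only: of_int_eq_iff)
  with \<open>even q\<close> assms(2) show False by simp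
qed

section \<open>Exponential decay along the rows\<close>

lemmas sin_half_lattice_point = sin_pi_times_neq_0[OF half_lattice_point_notin_Ints]

text \<open>The constants do not depend on tau in the half plane Im tau > delta, as locally uniform
  convergence in tau requires.\<close>

lemma norm_csc_half_lattice_point_le:
  assumes "\<delta> > 0"
  obtains C r where "0 \<le> C" "0 \<le> r" "r < 1"
    "\<And>\<tau> n. \<delta> < Im \<tau> \<Longrightarrow> norm (csc (half_lattice_point p q \<tau> n)) \<le> C * r ^ nat \<bar>n\<bar>"
proof -
  \<comment> \<open>If 2n + q is not 0, the point is at distance at least delta / 2 from the real
    axis and K applies; L takes care of the possible real point p / 2. E compensates for replacing
    |2n + q| by 2|n| - |q| in the exponent.\<close>
  define K r where "K = 2 * pi / (1 - exp (- (2 * pi * (\<delta> / 2))))" and "r = exp (- (pi * \<delta>))"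
  define L where "L = norm (csc (of_int p / 2))"
  define E where "E = exp (pi * \<delta> * \<bar>q\<bar> / 2)"
  have K: "K \<ge> 0" using assms by (simp add: K_def)
  have L: "L \<ge> 0" by (simp add: L_def)
  have r: "r ^ nat \<bar>n\<bar> = exp (- (pi * \<delta> * \<bar>n\<bar>))" for n
    by (simp add: r_def mult_ac flip: exp_of_nat_mult)
  have "norm (csc (half_lattice_point p q \<tau> n)) \<le> (K + L) * E * r ^ nat \<bar>n\<bar>" if "\<delta> < Im \<tau>" for \<tau> n
  proof (cases "2 * n + q = 0")
    case True
    then have "pi * \<delta> * \<bar>q\<bar> / 2 - pi * \<delta> * \<bar>n\<bar> = 0"
      by (simp add: abs_if split: if_splits)
    then have 1: "E * r ^ nat \<bar>n\<bar> = 1"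
      unfolding E_def r by (simp flip: exp_add)
    have "norm (csc (half_lattice_point p q \<tau> n)) = L"
      unfolding half_lattice_point_def True by (simp add: L_def)
    also have "\<dots> \<le> (K + L) * (E * r ^ nat \<bar>n\<bar>)"
      unfolding 1 using K by simp
    finally show ?thesis by (simp add: mult_ac)
  next
    case False
    let ?w = "half_lattice_point p q \<tau> n"
    have Im: "\<bar>Im ?w\<bar> = \<bar>2 * n + q\<bar> * Im \<tau> / 2"
      using assms that by (simp add: half_lattice_point_def abs_mult)
    have ge: "\<bar>2 * n + q\<bar> * \<delta> / 2 \<le> \<bar>Im ?w\<bar>"
      unfolding Im using that by (intro divide_right_mono mult_left_mono) auto
    have "1 \<le> \<bar>2 * n + q\<bar>" using False by linarith
    then have "1 * \<delta> / 2 \<le> \<bar>2 * n + q\<bar> * \<delta> / 2"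
      using assms by (intro divide_right_mono mult_right_mono) linarith+
    with ge have "\<delta> / 2 \<le> \<bar>Im ?w\<bar>" by simp
    then have "norm (csc ?w) \<le> K * exp (- (pi * \<bar>Im ?w\<bar>))"
      unfolding K_def using assms by (intro norm_csc_le) auto
    also have "\<dots> \<le> K * exp (pi * \<delta> * \<bar>q\<bar> / 2 - pi * \<delta> * \<bar>n\<bar>)"
    proof -
      have "2 * \<bar>n\<bar> - \<bar>q\<bar> \<le> \<bar>2 * n + q\<bar>" by linarith
      then have "real_of_int (2 * \<bar>n\<bar> - \<bar>q\<bar>) \<le> real_of_int \<bar>2 * n + q\<bar>" by linarith
      then have "(2 * \<bar>n\<bar> - \<bar>q\<bar>) * \<delta> / 2 \<le> \<bar>2 * n + q\<bar> * \<delta> / 2"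
        using assms by (intro divide_right_mono mult_right_mono) auto
      with ge have "(2 * \<bar>n\<bar> - \<bar>q\<bar>) * \<delta> / 2 \<le> \<bar>Im ?w\<bar>" by linarith
      then have "pi * ((2 * \<bar>n\<bar> - \<bar>q\<bar>) * \<delta> / 2) \<le> pi * \<bar>Im ?w\<bar>"
        by (intro mult_left_mono) auto
      then show ?thesis using K by (intro mult_left_mono) (auto simp: algebra_simps)
    qed
    also have "\<dots> = K * (E * r ^ nat \<bar>n\<bar>)"
      by (simp add: E_def r flip: exp_add)
    also have "\<dots> \<le> (K + L) * (E * r ^ nat \<bar>n\<bar>)"
      using L by (intro mult_right_mono) (auto simp: E_def r)
    finally show ?thesis by (simp add: mult_ac)
  qed
  moreover have "0 \<le> (K + L) * E" "0 \<le> r" "r < 1"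
    using K L assms by (simp_all add: E_def r_def)
  ultimately show thesis using that by blast
qed

lemma norm_csc_half_lattice_point_le':
  assumes "Im \<tau> > 0"
  obtains C r where "0 \<le> C" "0 \<le> r" "r < 1"
    "\<And>n. norm (csc (half_lattice_point p q \<tau> n)) \<le> C * r ^ nat \<bar>n\<bar>"
proof -
  have "Im \<tau> / 2 > 0" "Im \<tau> / 2 < Im \<tau>" using assms by auto
  then show thesis
    using norm_csc_half_lattice_point_le[of "Im \<tau> / 2" p q] that by metis
qed

lemma bounded_csc_half_lattice_point:
  assumes "Im \<tau> > 0"
  obtains C where "0 \<le> C" "\<And>n. norm (csc (half_lattice_point p q \<tau> n)) \<le> C"
proof -
  from norm_csc_half_lattice_point_le'[OF assms, of p q] obtain C r where
    C: "0 \<le> C" "0 \<le> r" "r < 1" "\<And>n. norm (csc (half_lattice_point p q \<tau> n)) \<le> C * r ^ nat \<bar>n\<bar>"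
    by blast
  have "C * r ^ nat \<bar>n\<bar> \<le> C * 1" for n
    using C by (intro mult_left_mono power_le_one) auto
  then show thesis using C that by (metis order_trans mult_1_right)
qed

lemma summable_norm_csc_half_lattice_point:
  assumes "Im \<tau> > 0"
  shows "(\<lambda>n. norm (csc (half_lattice_point p q \<tau> n))) summable_on UNIV"
proof -
  from norm_csc_half_lattice_point_le'[OF assms, of p q] obtain C r where
    C: "0 \<le> C" "0 \<le> r" "r < 1" "\<And>n. norm (csc (half_lattice_point p q \<tau> n)) \<le> C * r ^ nat \<bar>n\<bar>"
    by blast
  show ?thesis
    by (rule Infinite_Sum.abs_summable_on_comparison_test'[OF _ C(4)])
      (intro summable_on_cmult_right summable_on_int_power_abs C)
qed

lemma summable_norm_bounded_mult:
  fixes f g :: "'a \<Rightarrow> complex"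
  assumes "(\<lambda>n. norm (f n)) summable_on A" "\<And>n. norm (g n) \<le> C"
  shows "(\<lambda>n. norm (g n * f n)) summable_on A"
proof (rule Infinite_Sum.abs_summable_on_comparison_test')
  show "(\<lambda>n. C * norm (f n)) summable_on A" by (intro summable_on_cmult_right assms)
  show "norm (g n * f n) \<le> C * norm (f n)" for n
    using assms(2)[of n] by (simp add: norm_mult mult_right_mono)
qed

lemma summable_norm_csc_squared_half_lattice_point:
  assumes "Im \<tau> > 0"
  shows "(\<lambda>n. norm (csc (half_lattice_point p q \<tau> n) ^ 2)) summable_on UNIV"
proof -
  from bounded_csc_half_lattice_point[OF assms, of p q] obtain C where
    "\<And>n. norm (csc (half_lattice_point p q \<tau> n)) \<le> C" by blast
  from summable_norm_bounded_mult[OF summable_norm_csc_half_lattice_point[OF assms] this]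
  show ?thesis by (simp add: power2_eq_square)
qed

lemma has_sum_csc_series:
  assumes "Im \<tau> > 0"
  shows "((\<lambda>n. csc (half_lattice_point p q \<tau> n) ^ 2) has_sum csc_series p q \<tau>) UNIV"
  unfolding csc_series_def
  by (rule has_sum_infsum[OF abs_summable_summable[OF
      summable_norm_csc_squared_half_lattice_point[OF assms]]])

text \<open>The cotangents are bounded because the cosecants are, by \<open>ctn_squared\<close>; a
  bounded factor preserves absolute summability.\<close>

lemma summable_ctn_csc_squared_half_lattice_point:
  assumes "Im \<tau> > 0" "odd p \<or> odd q"
  shows "(\<lambda>n. ctn (half_lattice_point p q \<tau> n) * csc (half_lattice_point p q \<tau> n) ^ 2) summable_on UNIV"
proof -
  from bounded_csc_half_lattice_point[OF assms(1), of p q] obtain C where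
    C: "\<And>n. norm (csc (half_lattice_point p q \<tau> n)) \<le> C" by blast
  have "norm (ctn (half_lattice_point p q \<tau> n)) ^ 2 \<le> C ^ 2 + pi ^ 2" for n
  proof -
    let ?w = "half_lattice_point p q \<tau> n"
    have "norm (ctn ?w) ^ 2 = norm (csc ?w ^ 2 - of_real pi ^ 2)"
      by (simp add: ctn_squared[OF sin_half_lattice_point[OF assms]] flip: norm_power)
    also have "\<dots> \<le> norm (csc ?w) ^ 2 + norm (of_real pi :: complex) ^ 2"
      by (metis norm_triangle_ineq4 norm_power)
    also have "\<dots> \<le> C ^ 2 + pi ^ 2"
      using C[of n] by (simp add: power_mono)
    finally show ?thesis .
  qed
  then have "norm (ctn (half_lattice_point p q \<tau> n)) \<le> sqrt (C ^ 2 + pi ^ 2)" for n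
    by (rule real_le_rsqrt)
  from abs_summable_summable[OF summable_norm_bounded_mult[OF
      summable_norm_csc_squared_half_lattice_point[OF assms(1)] this]]
  show ?thesis .
qed

text \<open>The reflection n -> -n-q sends each point to its negative plus the integer p. The
  summand is odd and 1-periodic, so the sum equals its own negative.\<close>

lemma infsum_ctn_csc_squared_half_lattice_point:
  "(\<Sum>\<^sub>\<infinity>n. ctn (half_lattice_point p q \<tau> n) * csc (half_lattice_point p q \<tau> n) ^ 2) = 0"
proof -
  define f where "f w = ctn w * csc w ^ 2" for w
  have per: "f (w + of_int k) = f w" for w k
    by (simp add: f_def ctn_plus_int csc_squared_plus_int)
  have odd: "f (- w) = - f w" for w
    by (simp add: f_def ctn_minus csc_minus)
  have "bij_betw (\<lambda>n. - n - q) UNIV UNIV"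
    by (rule bij_betwI[of _ _ _ "\<lambda>n. - n - q"]) auto
  then have "(\<Sum>\<^sub>\<infinity>n. f (half_lattice_point p q \<tau> n)) = (\<Sum>\<^sub>\<infinity>n. f (half_lattice_point p q \<tau> (- n - q)))"
    using infsum_reindex_bij_betw[of "\<lambda>n. - n - q" UNIV UNIV "\<lambda>n. f (half_lattice_point p q \<tau> n)"]
    by simp
  also have "half_lattice_point p q \<tau> (- n - q) = - half_lattice_point p q \<tau> n + of_int p" for n
    by (simp add: half_lattice_point_def field_simps)
  then have "(\<lambda>n. f (half_lattice_point p q \<tau> (- n - q))) = (\<lambda>n. - f (half_lattice_point p q \<tau> n))"
    by (simp only: per odd)
  also have "infsum \<dots> UNIV = - (\<Sum>\<^sub>\<infinity>n. f (half_lattice_point p q \<tau> n))"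
    by (rule infsum_uminus)
  finally show ?thesis by (simp add: f_def)
qed

section \<open>Termwise differentiation of the row series\<close>

lemma DERIV_csc:
  assumes "sin (of_real pi * w) \<noteq> 0"
  shows "(csc has_field_derivative - (ctn w * csc w)) (at w)"
proof -
  have "((\<lambda>w. of_real pi / sin (of_real pi * w)) has_field_derivative
      (0 * sin (of_real pi * w) - of_real pi * (of_real pi * cos (of_real pi * w))) /
      (sin (of_real pi * w) * sin (of_real pi * w))) (at w)"
    by (intro DERIV_divide assms) (auto intro!: derivative_eq_intros)
  then show ?thesis by (simp add: csc_def[abs_def] ctn_def mult_ac)
qed

lemma DERIV_csc_squared_half_lattice_point:
  assumes "Im \<tau> > 0" "odd p \<or> odd q"
  shows "((\<lambda>\<tau>. csc (half_lattice_point p q \<tau> n) ^ 2) has_field_derivative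
    - (of_int (2 * n + q) * (ctn (half_lattice_point p q \<tau> n) * csc (half_lattice_point p q \<tau> n) ^ 2)))
    (at \<tau>)"
proof -
  let ?w = "half_lattice_point p q \<tau> n"
  have "((\<lambda>\<tau>. half_lattice_point p q \<tau> n) has_field_derivative of_int (2 * n + q) / 2) (at \<tau>)"
    unfolding half_lattice_point_def by (auto intro!: derivative_eq_intros)
  from DERIV_chain2[OF DERIV_csc[OF sin_half_lattice_point[OF assms]] this]
  have "((\<lambda>\<tau>. csc (half_lattice_point p q \<tau> n)) has_field_derivative
      - (ctn ?w * csc ?w) * (of_int (2 * n + q) / 2)) (at \<tau>)" .
  from DERIV_power[OF this, of 2] show ?thesis
    by (simp add: power2_eq_square mult_ac)
qed

lemma has_sum_int_imp_sums:
  assumes "(f has_sum S) (UNIV :: int set)"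
  shows "(\<lambda>n. f (int_decode n)) sums S"
  using assms has_sum_reindex_bij_betw[OF bij_int_decode, of f S] by (blast intro: has_sum_imp_sums)

text \<open>A summable majorant of the holomorphic terms, uniform on the half plane
  \<open>U\<close>, yields termwise differentiation. The sum S of the differentiated series is left
  to the caller, since its evaluation is the content of the Halphen system.\<close>

lemma DERIV_csc_series:
  assumes \<tau>: "Im \<tau> > 0" and pq: "odd p \<or> odd q"
    and S: "((\<lambda>n. - (of_int (2 * n + q) * (ctn (half_lattice_point p q \<tau> n) *
      csc (half_lattice_point p q \<tau> n) ^ 2))) has_sum S) UNIV"
  shows "(csc_series p q has_field_derivative S) (at \<tau>)"
proof -
  define \<delta> where "\<delta> = Im \<tau> / 2"
  have \<delta>: "\<delta> > 0" "\<delta> < Im \<tau>" using \<tau> by (auto simp: \<delta>_def)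
  define U where "U = {x. \<delta> < Im x}"
  have U: "open U" "\<tau> \<in> U"
    using \<delta> by (auto simp: U_def open_halfspace_Im_gt)
  define D where "D = (\<lambda>n x. - (of_int (2 * n + q) * (ctn (half_lattice_point p q x n) *
      csc (half_lattice_point p q x n) ^ 2)))"
  from norm_csc_half_lattice_point_le[OF \<delta>(1), of p q] obtain C r where
    C: "0 \<le> C" "0 \<le> r" "r < 1"
    "\<And>\<tau> n. \<delta> < Im \<tau> \<Longrightarrow> norm (csc (half_lattice_point p q \<tau> n)) \<le> C * r ^ nat \<bar>n\<bar>"
    by blast
  have "(r ^ nat \<bar>n\<bar>) ^ 2 \<le> r ^ nat \<bar>n\<bar>" for n
    using power_decreasing[of 1 2 "r ^ nat \<bar>n\<bar>"] C by (simp add: power_le_one)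
  then have bound: "norm (csc (half_lattice_point p q x n) ^ 2) \<le> C ^ 2 * r ^ nat \<bar>n\<bar>" if "x \<in> U" for x n
  proof -
    have "norm (csc (half_lattice_point p q x n)) ^ 2 \<le> (C * r ^ nat \<bar>n\<bar>) ^ 2"
      using C(4)[of x n] that by (intro power_mono) (auto simp: U_def)
    also have "\<dots> \<le> C ^ 2 * r ^ nat \<bar>n\<bar>"
      unfolding power_mult_distrib using \<open>(r ^ nat \<bar>n\<bar>) ^ 2 \<le> r ^ nat \<bar>n\<bar>\<close>
      by (intro mult_left_mono) auto
    finally show ?thesis by (simp add: norm_power)
  qed
  have "summable (\<lambda>n. C ^ 2 * r ^ nat \<bar>int_decode n\<bar>)"
    using has_sum_int_imp_sums[OF has_sum_infsum[OF summable_on_int_power_abs[OF C(2,3)]]]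
    by (intro summable_mult) (auto simp: sums_iff)
  moreover have "((\<lambda>x. csc (half_lattice_point p q x (int_decode n)) ^ 2) has_field_derivative
      D (int_decode n) x) (at x)" if "x \<in> U" for n x
    unfolding D_def using that \<delta> by (intro DERIV_csc_squared_half_lattice_point pq) (auto simp: U_def)
  moreover have "\<forall>\<^sub>F n in sequentially. \<forall>x\<in>U.
      norm (csc (half_lattice_point p q x (int_decode n)) ^ 2) \<le> C ^ 2 * r ^ nat \<bar>int_decode n\<bar>"
    using bound by simp
  ultimately obtain g g'
    where gg: "\<forall>x\<in>U. ((\<lambda>n. csc (half_lattice_point p q x (int_decode n)) ^ 2) sums g x) \<and>
      ((\<lambda>n. D (int_decode n) x) sums g' x) \<and> (g has_field_derivative g' x) (at x)"
    by (rule series_and_derivative_comparison[OF U(1)])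
  then have g: "\<And>x. x \<in> U \<Longrightarrow> (\<lambda>n. csc (half_lattice_point p q x (int_decode n)) ^ 2) sums g x"
    and g': "\<And>x. x \<in> U \<Longrightarrow> (\<lambda>n. D (int_decode n) x) sums g' x"
    and gg': "\<And>x. x \<in> U \<Longrightarrow> (g has_field_derivative g' x) (at x)"
    by blast+
  have "g x = csc_series p q x" if "x \<in> U" for x
  proof -
    have "Im x > 0" using that \<delta> by (simp add: U_def)
    from has_sum_int_imp_sums[OF has_sum_csc_series[OF this, of p q]] g[OF that]
    show ?thesis by (rule sums_unique2[symmetric])
  qed
  moreover have "g' \<tau> = S"
    using g'[OF U(2)] has_sum_int_imp_sums[OF S] unfolding D_def by (rule sums_unique2)
  ultimately show ?thesis
    using has_field_derivative_transform_within_open[OF gg'[OF U(2)] U] by metis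
qed

text \<open>Summability forces the cosecants along the row to tend to 0, and they bound the distance
  of the cotangents from their limits.\<close>

lemma
  assumes "Im \<tau> > 0" "odd p \<or> odd q"
  shows ctn_half_lattice_point_tendsto_top:
      "(\<lambda>N. ctn (half_lattice_point p q \<tau> (int N + k))) \<longlonglongrightarrow> - (of_real pi * \<i>)"
    and ctn_half_lattice_point_tendsto_bot:
      "(\<lambda>N. ctn (half_lattice_point p q \<tau> (- int N + k))) \<longlonglongrightarrow> of_real pi * \<i>"
proof -
  let ?w = "half_lattice_point p q \<tau>"
  have summable: "(\<lambda>n. norm (csc (?w n))) summable_on UNIV"
    by (rule summable_norm_csc_half_lattice_point[OF assms(1)])
  have lim: "(\<lambda>N. norm (csc (?w (h N)))) \<longlonglongrightarrow> 0" if "inj h" for h :: "nat \<Rightarrow> int"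
  proof -
    have "(\<lambda>n. norm (csc (?w n))) summable_on range h"
      using summable by (rule summable_on_subset) auto
    then have "(\<lambda>N. norm (csc (?w (h N)))) summable_on UNIV"
      using summable_on_reindex[OF that, of "\<lambda>n. norm (csc (?w n))"] by (simp add: o_def)
    then show ?thesis
      by (intro summable_LIMSEQ_zero summable_on_imp_summable)
  qed
  \<comment> \<open>From this index on, the sign of 2 (N + k) + q, respectively 2 (-N + k) + q, is
    settled, and so is the half plane in which the point lies.\<close>
  define M where "M = nat (\<bar>q\<bar> + \<bar>k\<bar>)"
  show "(\<lambda>N. ctn (?w (int N + k))) \<longlonglongrightarrow> - (of_real pi * \<i>)"
  proof (rule LIM_zero_cancel, rule Lim_null_comparison)
    show "(\<lambda>N. norm (csc (?w (int N + k)))) \<longlonglongrightarrow> 0" by (rule lim) (auto intro: injI)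
    have "norm (ctn (?w (int N + k)) - - (of_real pi * \<i>)) \<le> norm (csc (?w (int N + k)))" if "N \<ge> M" for N
    proof -
      have "0 \<le> 2 * (int N + k) + q" using that by (simp add: M_def)
      then have "0 \<le> real_of_int (2 * (int N + k) + q)" by linarith
      then have "0 \<le> Im (?w (int N + k))"
        using assms(1) by (simp add: half_lattice_point_def)
      then show ?thesis
        using ctn_plus_pi_i[OF sin_half_lattice_point[OF assms, of "int N + k"]]
        by (simp add: norm_mult mult_left_le)
    qed
    then show "\<forall>\<^sub>F N in sequentially. norm (ctn (?w (int N + k)) - - (of_real pi * \<i>))
        \<le> norm (csc (?w (int N + k)))"
      by (auto intro: eventually_sequentiallyI[of M])
  qed
  show "(\<lambda>N. ctn (?w (- int N + k))) \<longlonglongrightarrow> of_real pi * \<i>"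
  proof (rule LIM_zero_cancel, rule Lim_null_comparison)
    show "(\<lambda>N. norm (csc (?w (- int N + k)))) \<longlonglongrightarrow> 0" by (rule lim) (auto intro: injI)
    have "norm (ctn (?w (- int N + k)) - of_real pi * \<i>) \<le> norm (csc (?w (- int N + k)))" if "N \<ge> M" for N
    proof -
      have "2 * (- int N + k) + q \<le> 0" using that by (simp add: M_def)
      then have "real_of_int (2 * (- int N + k) + q) \<le> 0" by linarith
      then have "Im (?w (- int N + k)) \<le> 0"
        using assms(1) by (simp add: half_lattice_point_def mult_le_0_iff)
      then show ?thesis
        using ctn_minus_pi_i[OF sin_half_lattice_point[OF assms, of "- int N + k"]]
        by (simp add: norm_mult mult_left_le mult_le_0_iff)
    qed
    then show "\<forall>\<^sub>F N in sequentially. norm (ctn (?w (- int N + k)) - of_real pi * \<i>)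
        \<le> norm (csc (?w (- int N + k)))"
      by (auto intro: eventually_sequentiallyI[of M])
  qed
qed

text \<open>Only the vanishing sums of the parameters and the parity conditions enter, so that
  permuting the three pairs gives all equations of the system.\<close>

lemma DERIV_csc_series_halphen:
  assumes \<tau>: "Im \<tau> > 0"
    and pq: "p1 + p2 + p3 = 0" "q1 + q2 + q3 = 0"
    and odd: "odd p1 \<or> odd q1" "odd p2 \<or> odd q2" "odd p3 \<or> odd q3"
  shows "(csc_series p3 q3 has_field_derivative
    (csc_series p1 q1 \<tau> * csc_series p2 q2 \<tau>
      - csc_series p3 q3 \<tau> * (csc_series p1 q1 \<tau> + csc_series p2 q2 \<tau>))
    / (2 * of_real pi * \<i>)) (at \<tau>)"
proof -
  define u v w where "u = half_lattice_point p1 q1 \<tau>" and "v = half_lattice_point p2 q2 \<tau>"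
    and "w = half_lattice_point p3 q3 \<tau>"
  define A1 A2 A3 where "A1 = csc_series p1 q1 \<tau>" and "A2 = csc_series p2 q2 \<tau>"
    and "A3 = csc_series p3 q3 \<tau>"
  define X where "X = A1 * A2 - A3 * A1 - A3 * A2"
  have sin: "sin (of_real pi * u n) \<noteq> 0" "sin (of_real pi * v n) \<noteq> 0" "sin (of_real pi * w n) \<noteq> 0" for n
    unfolding u_def v_def w_def by (intro sin_half_lattice_point \<tau> odd)+
  have uvw: "u n + v (- k - n) + w k = 0" for n k
  proof -
    have "u n + v (- k - n) + w k
        = (of_int (p1 + p2 + p3) + of_int (q1 + q2 + q3) * \<tau>) / 2"
      by (simp add: u_def v_def w_def half_lattice_point_def field_simps)
    then show ?thesis by (simp add: pq del: of_int_add)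
  qed

  have prod: "((\<lambda>(k, n). csc (half_lattice_point p q \<tau> k) ^ 2 * csc (half_lattice_point p' q' \<tau> n) ^ 2)
      has_sum csc_series p q \<tau> * csc_series p' q' \<tau>) (UNIV \<times> UNIV)" for p q p' q'
    unfolding csc_series_def
    by (intro has_sum_product summable_norm_csc_squared_half_lattice_point \<tau>)
  \<comment> \<open>The pair (k, n) stands for the rows n of u, -k-n of v and k of w. These
    bijections pass to the pairs of row indices in which each product of two series is a double
    sum.\<close>
  have bij1: "bij_betw (\<lambda>(k, n). (n, - k - n)) UNIV (UNIV :: (int \<times> int) set)"
    by (rule bij_betwI[of _ _ _ "\<lambda>(n, m). (- n - m, n)"]) auto
  have bij2: "bij_betw (\<lambda>(k, n). (k, - k - n)) UNIV (UNIV :: (int \<times> int) set)"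
    by (rule bij_betwI[of _ _ _ "\<lambda>(k, m). (k, - k - m)"]) auto
  have "((\<lambda>(k, n). csc (u n) ^ 2 * csc (v (- k - n)) ^ 2) has_sum A1 * A2) UNIV"
    using prod[of p1 q1 p2 q2, unfolded UNIV_Times_UNIV]
      has_sum_reindex_bij_betw[OF bij1, of "\<lambda>(n, m). csc (u n) ^ 2 * csc (v m) ^ 2" "A1 * A2"]
    by (simp add: u_def v_def A1_def A2_def case_prod_unfold)
  moreover have "((\<lambda>(k, n). csc (w k) ^ 2 * csc (u n) ^ 2) has_sum A3 * A1) UNIV"
    using prod[of p3 q3 p1 q1, unfolded UNIV_Times_UNIV]
    by (simp add: u_def w_def A1_def A3_def)
  moreover have "((\<lambda>(k, n). csc (w k) ^ 2 * csc (v (- k - n)) ^ 2) has_sum A3 * A2) UNIV"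
    using prod[of p3 q3 p2 q2, unfolded UNIV_Times_UNIV]
      has_sum_reindex_bij_betw[OF bij2, of "\<lambda>(k, m). csc (w k) ^ 2 * csc (v m) ^ 2" "A3 * A2"]
    by (simp add: w_def v_def A3_def A2_def case_prod_unfold)
  ultimately have "((\<lambda>(k, n). csc (u n) ^ 2 * csc (v (- k - n)) ^ 2 - csc (w k) ^ 2 * csc (u n) ^ 2
      - csc (w k) ^ 2 * csc (v (- k - n)) ^ 2) has_sum X) UNIV"
    unfolding X_def case_prod_unfold by (intro has_sum_diff)
  \<comment> \<open>The addition identity at u n, v (-k-n), w k collapses the three products into
    one term, in which everything depending on k alone leaves the inner sum.\<close>
  also have "(\<lambda>(k, n). csc (u n) ^ 2 * csc (v (- k - n)) ^ 2 - csc (w k) ^ 2 * csc (u n) ^ 2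
      - csc (w k) ^ 2 * csc (v (- k - n)) ^ 2)
    = (\<lambda>(k, n). 2 * ctn (w k) * csc (w k) * (csc (u n) * csc (v (- k - n))))"
    using csc_squared_mult_csc_squared[OF uvw sin] by (auto simp: fun_eq_iff)
  finally have sum: "((\<lambda>(k, n). 2 * ctn (w k) * csc (w k) * (csc (u n) * csc (v (- k - n)))) has_sum X)
      (UNIV \<times> UNIV)"
    by (simp add: UNIV_Times_UNIV)

  define T where "T k = (\<Sum>\<^sub>\<infinity>n. csc (u n) * csc (v (- k - n)))" for k
  have T: "((\<lambda>n. csc (u n) * csc (v (- k - n))) has_sum T k) UNIV" for k
  proof -
    obtain C where "\<And>n. norm (csc (u n)) \<le> C"
      unfolding u_def using bounded_csc_half_lattice_point[OF \<tau>] by blast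
    moreover have "bij_betw (\<lambda>n. - k - n) UNIV UNIV"
      by (rule bij_betwI[of _ _ _ "\<lambda>n. - k - n"]) auto
    then have "(\<lambda>n. norm (csc (v (- k - n)))) summable_on UNIV"
      using summable_norm_csc_half_lattice_point[OF \<tau>, of p2 q2]
        summable_on_reindex_bij_betw[of "\<lambda>n. - k - n" UNIV UNIV "\<lambda>n. norm (csc (v n))"]
      by (simp add: v_def)
    ultimately have "(\<lambda>n. norm (csc (u n) * csc (v (- k - n)))) summable_on UNIV"
      by (intro summable_norm_bounded_mult)
    then show ?thesis
      unfolding T_def by (rule has_sum_infsum[OF abs_summable_summable])
  qed
  have outer: "((\<lambda>k. 2 * ctn (w k) * csc (w k) * T k) has_sum X) UNIV"
    by (rule has_sum_SigmaD[OF sum]) (use has_sum_cmult_right[OF T] in simp)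

  \<comment> \<open>By \<open>ctn_add_ctn\<close> this is the sum of the cotangents along the row k;
    unlike \<open>T k\<close>, it can be compared for neighbouring k.\<close>
  define R where "R k = - T k / csc (w k)" for k
  have w0: "csc (w k) \<noteq> 0" for k using sin by (simp add: csc_eq_0_iff)
  have R: "((\<lambda>n. ctn (u n) + ctn (v (- k - n))) has_sum R k) UNIV" for k
  proof -
    have "- (csc (u n) * csc (v (- k - n))) / csc (w k) = ctn (u n) + ctn (v (- k - n))" for n
      using ctn_add_ctn[OF uvw sin, of n k] w0 by simp
    with has_sum_divide_const[OF has_sum_uminusI[OF T[of k]], of "csc (w k)"]
    show ?thesis by (simp add: R_def)
  qed
  have step: "R (k + 1) = R k + 2 * of_real pi * \<i>" for k
  proof -
    \<comment> \<open>In \<open>R (k + 1) - R k\<close> the cotangents of u n cancel, and the index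
      of v moves from -k-n to -k-(n+1), a step in n. As this index falls when n grows, the upper
      limit of g is pi i and the lower one -pi i.\<close>
    define g where "g n = ctn (v (- k - n))" for n
    have "- (k + 1) - n = - k - (n + 1)" for n by simp
    with has_sum_diff[OF R[of "k + 1"] R[of k]]
    have "((\<lambda>n. g (n + 1) - g n) has_sum (R (k + 1) - R k)) UNIV"
      by (simp only: g_def add_diff_cancel_left)
    moreover have "((\<lambda>n. g (n + 1) - g n) has_sum (of_real pi * \<i> - - (of_real pi * \<i>))) UNIV"
    proof (rule has_sum_int_telescope)
      show "(\<lambda>n. g (n + 1) - g n) summable_on UNIV"
        using calculation by (rule has_sum_imp_summable)
      show "(\<lambda>N. g (int N)) \<longlonglongrightarrow> of_real pi * \<i>"
        using ctn_half_lattice_point_tendsto_bot[OF \<tau> odd(2), of "- k"]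
        by (simp add: g_def v_def algebra_simps)
      show "(\<lambda>N. g (- int N)) \<longlonglongrightarrow> - (of_real pi * \<i>)"
        using ctn_half_lattice_point_tendsto_top[OF \<tau> odd(2), of "- k"]
        by (simp add: g_def v_def algebra_simps)
    qed
    ultimately show ?thesis by (auto dest: has_sum_unique simp: algebra_simps)
  qed
  have R_eq: "R k = R 0 + 2 * of_real pi * \<i> * of_int k" for k
  proof (induction k rule: int_induct[where k = 0])
    case (step1 i)
    then show ?case using step[of i] by (simp add: algebra_simps)
  next
    case (step2 i)
    then show ?case using step[of "i - 1"] by (simp add: algebra_simps)
  qed simp

  (* The constant of the part of the row sums that is killed by the oddness of ctn * csc^2. *)
  define c where "c = 2 * of_real pi * \<i> * of_int q3 - 2 * R 0"
  have "((\<lambda>k. ctn (w k) * csc (w k) ^ 2) has_sum 0) UNIV"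
    using has_sum_infsum[OF summable_ctn_csc_squared_half_lattice_point[OF \<tau> odd(3)]]
    unfolding infsum_ctn_csc_squared_half_lattice_point w_def .
  from has_sum_diff[OF outer has_sum_cmult_right[OF this, of c]]
  have "((\<lambda>k. (2 * ctn (w k) * csc (w k) * T k - c * (ctn (w k) * csc (w k) ^ 2)) / (2 * of_real pi * \<i>))
      has_sum (X - c * 0) / (2 * of_real pi * \<i>)) UNIV"
    by (rule has_sum_divide_const)
  \<comment> \<open>The coefficient of ctn * csc^2 is -2 (R 0 + 2 pi i k) - c = -2 pi i (2k + q3),
    so division by 2 pi i leaves exactly the termwise derivative.\<close>
  moreover have "(2 * ctn (w k) * csc (w k) * T k - c * (ctn (w k) * csc (w k) ^ 2)) / (2 * of_real pi * \<i>)
      = - (of_int (2 * k + q3) * (ctn (w k) * csc (w k) ^ 2))" for k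
  proof -
    have T_eq: "T k = - csc (w k) * R k" using w0[of k] by (simp add: R_def)
    show ?thesis unfolding T_eq R_eq[of k] by (simp add: c_def field_simps power2_eq_square)
  qed
  ultimately have "(csc_series p3 q3 has_field_derivative (X - c * 0) / (2 * of_real pi * \<i>)) (at \<tau>)"
    unfolding w_def by (intro DERIV_csc_series[OF \<tau> odd(3)]) (simp only:)
  then show ?thesis by (simp add: X_def A1_def A2_def A3_def algebra_simps)
qed

section \<open>Row sums of the Weierstrass functions\<close>

lemma bij_betw_period_lattice:
  assumes "Im \<tau> > 0"
  shows "bij_betw (\<lambda>(n, m). of_int m + of_int n * \<tau>) UNIV (period_lattice \<tau>)"
proof (rule bij_betw_imageI)
  show "inj_on (\<lambda>(n, m). of_int m + of_int n * \<tau>) (UNIV :: (int \<times> int) set)"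
    using assms by (auto intro!: inj_onI simp: complex_eq_iff)
  show "(\<lambda>(n, m). of_int m + of_int n * \<tau>) ` UNIV = period_lattice \<tau>"
    by (auto simp: period_lattice_def)
qed

text \<open>The imaginary part controls n, and then the triangle inequality controls m.\<close>

lemma norm_lattice_point_ge:
  assumes "Im \<tau> > 0"
  obtains c where "c > 0"
    "\<And>n m. c * (\<bar>real_of_int n\<bar> + \<bar>real_of_int m\<bar>) \<le> norm (of_int m + of_int n * \<tau>)"
proof -
  define K where "K = 1 + norm \<tau> / Im \<tau> + 1 / Im \<tau>"
  have K: "K > 0" using assms by (simp add: K_def add_pos_nonneg)
  have "\<bar>real_of_int n\<bar> + \<bar>real_of_int m\<bar> \<le> norm (of_int m + of_int n * \<tau>) * K" for n m
  proof -
    let ?\<omega> = "of_int m + of_int n * \<tau>"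
    have "\<bar>real_of_int n\<bar> * Im \<tau> = \<bar>Im ?\<omega>\<bar>" using assms by (simp add: abs_mult)
    also have "\<dots> \<le> norm ?\<omega>" by (rule abs_Im_le_cmod)
    finally have n: "\<bar>real_of_int n\<bar> \<le> norm ?\<omega> / Im \<tau>"
      using assms by (simp add: pos_le_divide_eq)
    have "\<bar>real_of_int m\<bar> = norm (?\<omega> - of_int n * \<tau>)" by simp
    also have "\<dots> \<le> norm ?\<omega> + \<bar>real_of_int n\<bar> * norm \<tau>"
      by (metis norm_triangle_ineq4 norm_mult norm_of_int)
    also have "\<dots> \<le> norm ?\<omega> + norm ?\<omega> / Im \<tau> * norm \<tau>"
      using n by (intro add_left_mono mult_right_mono) auto
    finally show ?thesis using n by (simp add: K_def distrib_left)
  qed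
  then show thesis using K that[of "1 / K"] by (simp add: field_simps)
qed

lemma summable_on_int_powr:
  fixes s :: real
  assumes "s < -1"
  shows "(\<lambda>n::int. (1 + \<bar>real_of_int n\<bar>) powr s) summable_on UNIV"
proof (rule summable_on_int_split)
  have "summable (\<lambda>n. real n powr s)"
    using assms by (simp add: summable_real_powr_iff)
  then have 1: "summable (\<lambda>n. real (Suc n) powr s)" "summable (\<lambda>n. real (Suc (Suc n)) powr s)"
    by (simp_all only: summable_Suc_iff[of "\<lambda>n. real (Suc n) powr s"]
        summable_Suc_iff[of "\<lambda>n. real n powr s"])
  show "(\<lambda>n. (1 + \<bar>real_of_int (int n)\<bar>) powr s) summable_on UNIV"
    using 1(1) by (intro summable_nonneg_imp_summable_on) (auto simp: add_ac)
  have "1 + \<bar>real_of_int (- int n - 1)\<bar> = real (Suc (Suc n))" for n by simp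
  then show "(\<lambda>n. (1 + \<bar>real_of_int (- int n - 1)\<bar>) powr s) summable_on UNIV"
    using 1(2) by (simp only:) (intro summable_nonneg_imp_summable_on, auto)
qed

text \<open>With s = |n| + |m| > 1 one has (1 + |n|)(1 + |m|) <= (2s)^2. Raising this to the power
  3/2 bounds cubic decay in s by a product of two summable functions of n and of m.\<close>

lemma summable_on_period_lattice:
  fixes f :: "complex \<Rightarrow> complex"
  assumes \<tau>: "Im \<tau> > 0"
    and f: "\<And>\<omega>. B \<le> norm \<omega> \<Longrightarrow> norm (f \<omega>) \<le> K / norm \<omega> ^ 3"
  shows "f summable_on period_lattice \<tau>"
proof -
  define l :: "int \<times> int \<Rightarrow> complex" where "l = (\<lambda>(n, m). of_int m + of_int n * \<tau>)"
  from norm_lattice_point_ge[OF \<tau>] obtain c where c: "c > 0"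
    "\<And>n m. c * (\<bar>real_of_int n\<bar> + \<bar>real_of_int m\<bar>) \<le> norm (l (n, m))"
    unfolding l_def by auto
  \<comment> \<open>Beyond M both 1 + s <= 2s and B <= c s hold; the finitely many pairs in
    \<open>E\<close> are treated separately.\<close>
  define M where "M = max 1 (max B 0 / c)"
  define E where "E = {(n, m). \<bar>real_of_int n\<bar> + \<bar>real_of_int m\<bar> \<le> M}"
  define K' where "K' = \<bar>K\<bar> * (8 / c ^ 3)"
  define h where "h n = (1 + \<bar>real_of_int n\<bar>) powr (- 3 / 2)" for n
  have h: "h summable_on UNIV" unfolding h_def by (rule summable_on_int_powr) simp
  have h_nonneg: "h n \<ge> 0" for n by (simp add: h_def)
  have "E \<subseteq> {- \<lceil>M\<rceil>..\<lceil>M\<rceil>} \<times> {- \<lceil>M\<rceil>..\<lceil>M\<rceil>}"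
    by (auto simp: E_def; linarith)
  then have "finite E" by (rule finite_subset) simp
  then have 1: "(\<lambda>x. f (l x)) summable_on E" by simp
  have "(\<lambda>(n, m). h n * h m) summable_on UNIV \<times> UNIV"
  proof (rule summable_on_SigmaI)
    show "((\<lambda>m. case (n, m) of (n, m) \<Rightarrow> h n * h m) has_sum (h n * infsum h UNIV)) UNIV" for n
      using has_sum_cmult_right[OF has_sum_infsum[OF h]] by simp
    show "(\<lambda>n. h n * infsum h UNIV) summable_on UNIV"
      by (rule summable_on_cmult_left[OF h])
  qed (simp add: h_nonneg)
  then have "(\<lambda>(n, m). h n * h m) summable_on - E"
    by (rule summable_on_subset) auto
  then have "(\<lambda>x. K' * (case x of (n, m) \<Rightarrow> h n * h m)) summable_on - E"
    by (rule summable_on_cmult_right)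
  then have "(\<lambda>x. norm (f (l x))) summable_on - E"
  proof (rule Infinite_Sum.abs_summable_on_comparison_test')
    fix x assume "x \<in> - E"
    then obtain n m where x: "x = (n, m)" and "\<bar>real_of_int n\<bar> + \<bar>real_of_int m\<bar> > M"
      by (cases x) (auto simp: E_def)
    define s where "s = \<bar>real_of_int n\<bar> + \<bar>real_of_int m\<bar>"
    define P where "P = (1 + \<bar>real_of_int n\<bar>) * (1 + \<bar>real_of_int m\<bar>)"
    have s: "s > 1" "s > max B 0 / c"
      using \<open>_ > M\<close> by (simp_all add: s_def M_def)
    have cs: "0 < c * s" "c * s \<le> norm (l x)"
      using s(1) c(1) c(2)[of n m] by (simp_all add: s_def x)
    have P1: "P \<ge> 1" unfolding P_def using mult_mono[of 1 "1 + \<bar>real_of_int n\<bar>" 1 "1 + \<bar>real_of_int m\<bar>"] by simp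
    have "P \<le> (1 + s) * (1 + s)"
      unfolding P_def s_def by (intro mult_mono) auto
    also have "\<dots> \<le> (2 * s) * (2 * s)" using s(1) by (intro mult_mono) auto
    also have "\<dots> = (2 * s) powr 2" using s(1) by (simp add: power2_eq_square)
    finally have "P powr (3 / 2) \<le> ((2 * s) powr 2) powr (3 / 2)"
      using P1 by (intro powr_mono2) auto
    also have "\<dots> = (2 * s) ^ 3" using s(1) by (simp only: powr_powr) simp
    finally have Ps: "P powr (3 / 2) \<le> 8 * s ^ 3" by (simp add: power_mult_distrib)
    have "B \<le> c * s" using s(2) c(1) by (simp add: field_simps max_def split: if_splits)
    with cs have "B \<le> norm (l x)" by simp
    then have "norm (f (l x)) \<le> K / norm (l x) ^ 3" by (rule f)
    also have "\<dots> \<le> \<bar>K\<bar> / norm (l x) ^ 3" by (intro divide_right_mono) auto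
    also have "\<dots> \<le> \<bar>K\<bar> / (c * s) ^ 3"
      using cs c(1) s(1) by (intro divide_left_mono power_mono mult_pos_pos zero_less_power) linarith+
    also have "\<dots> = K' / (8 * s ^ 3)"
      using c(1) s(1) by (simp add: K'_def power_mult_distrib field_simps)
    also have "\<dots> \<le> K' / P powr (3 / 2)"
      using Ps P1 c(1) s(1) by (intro divide_left_mono mult_pos_pos) (auto simp: K'_def)
    also have "\<dots> = K' * (h n * h m)"
      using powr_minus_divide[of P "3 / 2"] by (simp add: h_def P_def powr_mult)
    finally show "norm (f (l x)) \<le> K' * (case x of (n, m) \<Rightarrow> h n * h m)" by (simp add: x)
  qed
  then have "(\<lambda>x. f (l x)) summable_on - E" by (rule abs_summable_summable)
  from summable_on_union[OF 1 this] have "(\<lambda>x. f (l x)) summable_on UNIV" by simp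
  then show ?thesis
    using summable_on_reindex_bij_betw[OF bij_betw_period_lattice[OF \<tau>], of f] unfolding l_def by blast
qed

lemma period_lattice_eq_insert: "period_lattice \<tau> = insert 0 (period_lattice \<tau> - {0})"
proof -
  have "0 = of_int 0 + of_int 0 * \<tau>" by simp
  then have "0 \<in> period_lattice \<tau>" unfolding period_lattice_def by blast
  then show ?thesis by blast
qed

(* The point 0 may be included in the sum over the lattice because 1 / 0 = 0. *)
lemma has_sum_weierstrass_wp:
  assumes \<tau>: "Im \<tau> > 0"
  shows "((\<lambda>\<omega>. 1 / (z - \<omega>) ^ 2 - 1 / \<omega> ^ 2) has_sum weierstrass_wp \<tau> z) (period_lattice \<tau>)"
proof -
  let ?f = "\<lambda>\<omega>. 1 / (z - \<omega>) ^ 2 - 1 / \<omega> ^ 2"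
  have "?f summable_on period_lattice \<tau>"
  proof (rule summable_on_period_lattice[OF \<tau>])
    fix \<omega> :: complex assume \<omega>: "2 * norm z + 1 \<le> norm \<omega>"
    have pos: "0 < norm \<omega>" using \<omega> norm_ge_zero[of z] by linarith
    have le: "norm \<omega> / 2 \<le> norm (z - \<omega>)"
      using \<omega> norm_triangle_ineq2[of \<omega> z] by (simp add: norm_minus_commute)
    with pos have nz: "z \<noteq> \<omega>" "\<omega> \<noteq> 0" by auto
    \<comment> \<open>Over the common denominator the squares of the lattice point cancel, and the
      numerator is only linear in it.\<close>
    then have "?f \<omega> = (\<omega> ^ 2 - (z - \<omega>) ^ 2) / ((z - \<omega>) ^ 2 * \<omega> ^ 2)"
      by (simp add: diff_frac_eq)
    also have "\<omega> ^ 2 - (z - \<omega>) ^ 2 = z * (2 * \<omega> - z)" by algebra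
    finally have "norm (?f \<omega>) = norm z * norm (2 * \<omega> - z) / (norm (z - \<omega>) ^ 2 * norm \<omega> ^ 2)"
      by (simp add: norm_divide norm_mult norm_power)
    also have "\<dots> \<le> norm z * (3 * norm \<omega>) / ((norm \<omega> / 2) ^ 2 * norm \<omega> ^ 2)"
    proof (intro frac_le mult_left_mono mult_right_mono power_mono)
      have "norm (2 * \<omega> - z) \<le> 2 * norm \<omega> + norm z"
        using norm_triangle_ineq4[of "2 * \<omega>" z] by (simp add: norm_mult)
      then show "norm (2 * \<omega> - z) \<le> 3 * norm \<omega>" using \<omega> norm_ge_zero[of z] by linarith
    qed (use le pos in auto)
    also have "\<dots> = 12 * norm z / norm \<omega> ^ 3"
      using pos by (simp add: field_simps power2_eq_square power3_eq_cube)
    finally show "norm (?f \<omega>) \<le> 12 * norm z / norm \<omega> ^ 3" .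
  qed
  then have "?f summable_on period_lattice \<tau> - {0}" by (rule summable_on_subset) auto
  from has_sum_insert[OF _ has_sum_infsum[OF this], of 0]
  show ?thesis
    unfolding weierstrass_wp_def period_lattice_eq_insert[of \<tau>, symmetric] by simp
qed

text \<open>Away from 0 the three terms combine to z^2 / ((z - w) w^2) at the lattice point w, which
  decays cubically. At w = 0 the convention 1 / 0 = 0 leaves the principal term 1 / z.\<close>

lemma has_sum_weierstrass_zeta:
  assumes \<tau>: "Im \<tau> > 0"
  shows "((\<lambda>\<omega>. 1 / (z - \<omega>) + 1 / \<omega> + z / \<omega> ^ 2) has_sum weierstrass_zeta \<tau> z) (period_lattice \<tau>)"
proof -
  let ?f = "\<lambda>\<omega>. 1 / (z - \<omega>) + 1 / \<omega> + z / \<omega> ^ 2"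
  have "?f summable_on period_lattice \<tau>"
  proof (rule summable_on_period_lattice[OF \<tau>])
    fix \<omega> :: complex assume \<omega>: "2 * norm z + 1 \<le> norm \<omega>"
    have pos: "0 < norm \<omega>" using \<omega> norm_ge_zero[of z] by linarith
    have le: "norm \<omega> / 2 \<le> norm (z - \<omega>)"
      using \<omega> norm_triangle_ineq2[of \<omega> z] by (simp add: norm_minus_commute)
    with pos have nz: "z \<noteq> \<omega>" "\<omega> \<noteq> 0" by auto
    then have "?f \<omega> = z ^ 2 / ((z - \<omega>) * \<omega> ^ 2)"
      by (simp add: field_simps power2_eq_square)
    then have "norm (?f \<omega>) = norm z ^ 2 / (norm (z - \<omega>) * norm \<omega> ^ 2)"
      by (simp add: norm_divide norm_mult norm_power)
    also have "\<dots> \<le> norm z ^ 2 / (norm \<omega> / 2 * norm \<omega> ^ 2)"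
      using le pos by (intro frac_le mult_right_mono) auto
    also have "\<dots> = 2 * norm z ^ 2 / norm \<omega> ^ 3"
      using pos by (simp add: field_simps power2_eq_square power3_eq_cube)
    finally show "norm (?f \<omega>) \<le> 2 * norm z ^ 2 / norm \<omega> ^ 3" .
  qed
  then have "?f summable_on period_lattice \<tau> - {0}" by (rule summable_on_subset) auto
  from has_sum_insert[OF _ has_sum_infsum[OF this], of 0]
  show ?thesis
    unfolding weierstrass_zeta_def period_lattice_eq_insert[of \<tau>, symmetric] by simp
qed

lemma has_sum_weierstrass_wp_plus_eta:
  assumes \<tau>: "Im \<tau> > 0" and z: "\<And>n. of_int n * \<tau> - z \<notin> \<int>"
  shows "((\<lambda>n. csc (of_int n * \<tau> - z) ^ 2) has_sum (weierstrass_wp \<tau> z + 2 * eta1 \<tau>)) UNIV"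
proof -
  (* Adding the zeta series at 1/2 and its reflection cancels the 1 / \<omega>^2, and what is left of
     them telescopes along the rows. *)
  define F where "F \<omega> = 1 / (z - \<omega>) ^ 2 + (1 / (\<omega> + 1 / 2) - 1 / (\<omega> - 1 / 2))" for \<omega>
  define f where "f \<omega> = 1 / (1 / 2 - \<omega>) + 1 / \<omega> + (1 / 2) / \<omega> ^ 2" for \<omega> :: complex
  have f: "(f has_sum eta1 \<tau>) (period_lattice \<tau>)"
    using has_sum_weierstrass_zeta[OF \<tau>, of "1 / 2"]
    by (simp add: f_def[abs_def] eta1_def half_period1_def)
  have neg: "- \<omega> \<in> period_lattice \<tau>" if "\<omega> \<in> period_lattice \<tau>" for \<omega>
  proof -
    from that obtain m n where "\<omega> = of_int m + of_int n * \<tau>" by (auto simp: period_lattice_def)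
    then have "- \<omega> = of_int (- m) + of_int (- n) * \<tau>" by simp
    then show ?thesis unfolding period_lattice_def by blast
  qed
  have "bij_betw uminus (period_lattice \<tau>) (period_lattice \<tau>)"
    by (rule bij_betwI[of _ _ _ uminus]) (auto intro: neg)
  then have f': "((\<lambda>\<omega>. f (- \<omega>)) has_sum eta1 \<tau>) (period_lattice \<tau>)"
    using f has_sum_reindex_bij_betw[of uminus] by blast
  have "1 / (z - \<omega>) ^ 2 - 1 / \<omega> ^ 2 + f \<omega> + f (- \<omega>) = F \<omega>" for \<omega>
  proof -
    have "1 / (1 / 2 - \<omega>) = - (1 / (\<omega> - 1 / 2))"
      by (metis minus_diff_eq minus_divide_right)
    then show ?thesis by (simp add: f_def F_def add_ac)
  qed
  with has_sum_add[OF has_sum_add[OF has_sum_weierstrass_wp[OF \<tau>, of z] f] f']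
  have "(F has_sum (weierstrass_wp \<tau> z + eta1 \<tau> + eta1 \<tau>)) (period_lattice \<tau>)"
    by (simp only:)
  then have "(F has_sum (weierstrass_wp \<tau> z + 2 * eta1 \<tau>)) (period_lattice \<tau>)"
    by (simp only: mult_2 add.assoc)
  then have "((\<lambda>x. F (case x of (n, m) \<Rightarrow> of_int m + of_int n * \<tau>))
      has_sum (weierstrass_wp \<tau> z + 2 * eta1 \<tau>)) UNIV"
    using has_sum_reindex_bij_betw[OF bij_betw_period_lattice[OF \<tau>]] by blast
  then have sum: "((\<lambda>(n, m). F (of_int m + of_int n * \<tau>))
      has_sum (weierstrass_wp \<tau> z + 2 * eta1 \<tau>)) (UNIV \<times> UNIV)"
    by (simp add: case_prod_unfold)
  show ?thesis
  proof (rule has_sum_SigmaD[OF sum])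
    fix n :: int
    \<comment> \<open>Moving the lattice point by 1 along its row turns w - 1/2 into w + 1/2, so the
      zeta part of F is a difference of consecutive values of g.\<close>
    define g where "g m = 1 / (of_int m + (of_int n * \<tau> - 1 / 2))" for m
    have row: "((\<lambda>m. 1 / (z - (of_int m + of_int n * \<tau>)) ^ 2) has_sum csc (of_int n * \<tau> - z) ^ 2) UNIV"
      unfolding csc_def using has_sum_csc_squared[OF z[of n]]
      by (simp add: power2_commute[of z] algebra_simps)
    have F_eq: "F (of_int m + of_int n * \<tau>) =
        1 / (z - (of_int m + of_int n * \<tau>)) ^ 2 + (g (m + 1) - g m)" for m
      by (simp add: F_def g_def algebra_simps)
    have "((\<lambda>m. g (m + 1) - g m) has_sum (0 - 0)) UNIV"
    proof (rule has_sum_int_telescope)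
      \<comment> \<open>The row of F is summable as a section of the double family; subtracting the
        inverse squares shows that the differences of g are summable.\<close>
      have "(\<lambda>m. F (of_int m + of_int n * \<tau>)) summable_on UNIV"
        using summable_on_SigmaD1[OF has_sum_imp_summable[OF sum]] by simp
      from has_sum_imp_summable[OF has_sum_diff[OF has_sum_infsum[OF this] row]]
      show "(\<lambda>m. g (m + 1) - g m) summable_on UNIV" by (simp add: F_eq)
      have lim: "(\<lambda>N. 1 / (of_nat N + a :: complex)) \<longlonglongrightarrow> 0" for a
        by (intro tendsto_divide_0[OF tendsto_const] tendsto_add_filterlim_at_infinity'[OF tendsto_of_nat])
          auto
      show "(\<lambda>N. g (int N)) \<longlonglongrightarrow> 0" unfolding g_def using lim by simp
      have "g (- int N) = - (1 / (of_nat N + (1 / 2 - of_int n * \<tau>)))" for N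
        unfolding g_def by (subst minus_divide_right) (simp add: algebra_simps)
      then show "(\<lambda>N. g (- int N)) \<longlonglongrightarrow> 0" using tendsto_minus[OF lim] by simp
    qed
    from has_sum_add[OF row this]
    show "((\<lambda>m. case (n, m) of (n, m) \<Rightarrow> F (of_int m + of_int n * \<tau>)) has_sum csc (of_int n * \<tau> - z) ^ 2) UNIV"
      by (simp add: F_eq)
  qed
qed

section \<open>The derivatives\<close>

lemma csc_series_eq_weierstrass:
  assumes \<tau>: "Im \<tau> > 0" and odd: "odd p \<or> odd q"
    and z: "z = - ((of_int p + of_int q * \<tau>) / 2)"
  shows "csc_series p q \<tau> = weierstrass_wp \<tau> z + 2 * eta1 \<tau>"
proof -
  have "of_int n * \<tau> - z = half_lattice_point p q \<tau> n" for n
    by (simp add: z half_lattice_point_def field_simps)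
  with has_sum_weierstrass_wp_plus_eta[OF \<tau>, of z] half_lattice_point_notin_Ints[OF assms(1,2)]
  have "((\<lambda>n. csc (half_lattice_point p q \<tau> n) ^ 2) has_sum (weierstrass_wp \<tau> z + 2 * eta1 \<tau>)) UNIV"
    by simp
  with has_sum_csc_series[OF \<tau>, of p q] show ?thesis by (rule has_sum_unique)
qed

text \<open>The signs of the parameters are chosen so that (-1, 0), (1, 1) and (0, -1) add up to (0,
  0), as the Halphen system requires. The common shift by 2 eta1 cancels in differences of the
  e_i.\<close>

lemma
  assumes "Im \<tau> > 0"
  shows e1_eq_csc_series: "e1 \<tau> = csc_series (- 1) 0 \<tau> - 2 * eta1 \<tau>"
    and e2_eq_csc_series: "e2 \<tau> = csc_series 1 1 \<tau> - 2 * eta1 \<tau>"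
    and e3_eq_csc_series: "e3 \<tau> = csc_series 0 (- 1) \<tau> - 2 * eta1 \<tau>"
  by (simp_all add: e1_def e2_def e3_def half_period1_def half_period2_def half_period3_def
      csc_series_eq_weierstrass[OF assms, of "- 1" 0 "1 / 2"]
      csc_series_eq_weierstrass[OF assms, of 1 1 "- (1 / 2) - \<tau> / 2"]
      csc_series_eq_weierstrass[OF assms, of 0 "- 1" "\<tau> / 2"] add_divide_distrib)

lemma
  assumes "Im \<tau> > 0"
  defines "A1 \<equiv> csc_series (- 1) 0 \<tau>" and "A2 \<equiv> csc_series 1 1 \<tau>" and "A3 \<equiv> csc_series 0 (- 1) \<tau>"
  shows DERIV_csc_series_1: "(csc_series (- 1) 0 has_field_derivative
      (A2 * A3 - A1 * (A2 + A3)) / (2 * of_real pi * \<i>)) (at \<tau>)"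
    and DERIV_csc_series_2: "(csc_series 1 1 has_field_derivative
      (A1 * A3 - A2 * (A1 + A3)) / (2 * of_real pi * \<i>)) (at \<tau>)"
    and DERIV_csc_series_3: "(csc_series 0 (- 1) has_field_derivative
      (A1 * A2 - A3 * (A1 + A2)) / (2 * of_real pi * \<i>)) (at \<tau>)"
  unfolding A1_def A2_def A3_def by (intro DERIV_csc_series_halphen assms; simp)+

text \<open>If G is a primitive of g, then f exp (-G) is constant on the convex set U, and one
  nonzero value makes the constant nonzero.\<close>

lemma DERIV_eq_mult_imp_no_zero:
  fixes f g :: "complex \<Rightarrow> complex"
  assumes U: "open U" "convex U" and g: "g holomorphic_on U"
    and f: "\<And>x. x \<in> U \<Longrightarrow> (f has_field_derivative g x * f x) (at x)"
    and w: "w \<in> U" "f w \<noteq> 0" and x: "x \<in> U"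
  shows "f x \<noteq> 0"
proof -
  obtain G where G: "\<And>x. x \<in> U \<Longrightarrow> (G has_field_derivative g x) (at x within U)"
    using holomorphic_convex_primitive'[OF U(2,1) g] by blast
  have "((\<lambda>x. f x * exp (- G x)) has_field_derivative 0) (at x within U)" if "x \<in> U" for x
    by (rule derivative_eq_intros has_field_derivative_at_within[OF f] G that refl)+
      (simp add: algebra_simps)
  then have "\<exists>c. \<forall>x\<in>U. f x * exp (- G x) = c"
    by (rule has_field_derivative_zero_constant[OF U(2)])
  then obtain c where c: "\<And>x. x \<in> U \<Longrightarrow> f x * exp (- G x) = c"
    by blast
  with w have "c \<noteq> 0" by force
  with c[OF x] show ?thesis by auto
qed

lemma csc_squared_imaginary: "csc (\<i> * of_real y) ^ 2 = of_real (- ((pi / sinh (pi * y)) ^ 2))"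
proof -
  have "sin (of_real pi * (\<i> * of_real y)) = sin (\<i> * of_real (pi * y))"
    by (simp add: mult_ac)
  also have "\<dots> = \<i> * of_real (sinh (pi * y))"
    by (simp only: sin_i_times sinh_field_def exp_of_real exp_minus of_real_divide of_real_diff
        of_real_inverse of_real_numeral)
  finally have "sin (of_real pi * (\<i> * of_real y)) = \<i> * of_real (sinh (pi * y))" .
  then show ?thesis by (simp add: csc_def power_divide power_mult_distrib)
qed

lemma csc_squared_half_plus_imaginary:
  "csc (1 / 2 + \<i> * of_real y) ^ 2 = of_real ((pi / cosh (pi * y)) ^ 2)"
proof -
  have "sin (of_real pi * (1 / 2 + \<i> * of_real y)) = cos (\<i> * of_real (pi * y))"
    by (simp add: distrib_left sin_add mult.left_commute flip: sin_of_real cos_of_real)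
  also have "\<dots> = of_real (cosh (pi * y))"
    unfolding cosh_complex[symmetric]
    by (simp only: cosh_field_def exp_of_real exp_minus of_real_divide of_real_add
        of_real_inverse of_real_numeral)
  finally show ?thesis by (simp add: csc_def power_divide)
qed

text \<open>At 1 + i the points of the first series lie on integer translates of the imaginary axis,
  where csc^2 is real and negative away from the integers. Those of the second lie on translates of
  1/2 plus that axis, where it is positive.\<close>

lemma csc_series_2_minus_1_at_1_plus_i:
  "csc_series 1 1 (1 + \<i>) - csc_series (- 1) 0 (1 + \<i>) \<noteq> 0"
proof -
  have "half_lattice_point 1 1 (1 + \<i>) n = \<i> * of_real (of_int n + 1 / 2) + of_int (n + 1)" for n
    by (simp add: half_lattice_point_def field_simps)
  then have 2: "csc (half_lattice_point 1 1 (1 + \<i>) n) ^ 2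
      = of_real (- ((pi / sinh (pi * (of_int n + 1 / 2))) ^ 2))" for n
    by (simp only: csc_squared_plus_int csc_squared_imaginary)
  have "half_lattice_point (- 1) 0 (1 + \<i>) n = 1 / 2 + \<i> * of_real (of_int n) + of_int (n - 1)" for n
    by (simp add: half_lattice_point_def field_simps)
  then have 1: "csc (half_lattice_point (- 1) 0 (1 + \<i>) n) ^ 2
      = of_real ((pi / cosh (pi * of_int n)) ^ 2)" for n
    by (simp only: csc_squared_plus_int csc_squared_half_plus_imaginary)
  have Im: "Im (1 + \<i>) > 0" by simp
  have "0 \<le> - Re (csc_series 1 1 (1 + \<i>))"
    using has_sum_nonneg[OF has_sum_uminusI[OF has_sum_Re[OF has_sum_csc_series[OF Im, of 1 1]]]]
    unfolding 2 by simp
  \<comment> \<open>The term n = 0 alone contributes pi^2, as cosh 0 = 1, and makes the inequality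
    strict.\<close>
  moreover have "(\<Sum>n\<in>{0::int}. (pi / cosh (pi * of_int n)) ^ 2) \<le> Re (csc_series (- 1) 0 (1 + \<i>))"
    using has_sum_Re[OF has_sum_csc_series[OF Im, of "- 1" 0]]
    unfolding 1 Re_complex_of_real by (rule finite_sum_le_has_sum) auto
  then have "pi ^ 2 \<le> Re (csc_series (- 1) 0 (1 + \<i>))" by simp
  ultimately have "Re (csc_series 1 1 (1 + \<i>)) < Re (csc_series (- 1) 0 (1 + \<i>))"
    using zero_less_power[OF pi_gt_zero, of 2] by linarith
  then show ?thesis by auto
qed

text \<open>The products a b cancel between two Halphen equations, and the rest has the factor b -
  a: the quadratic system becomes a linear equation for each difference.\<close>

lemma halphen_difference:
  fixes a b c :: complex
  shows "(a * c - b * (a + c)) / (2 * of_real pi * \<i>) - (b * c - a * (b + c)) / (2 * of_real pi * \<i>)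
    = - (c / (of_real pi * \<i>)) * (b - a)"
proof -
  have "(a * c - b * (a + c)) - (b * c - a * (b + c)) = 2 * (- (c * (b - a)))"
    by (simp add: algebra_simps)
  then show ?thesis by (simp add: diff_divide_distrib[symmetric] mult.assoc)
qed

lemma DERIV_csc_series_2_minus_1:
  assumes "Im \<tau> > 0"
  shows "((\<lambda>\<tau>. csc_series 1 1 \<tau> - csc_series (- 1) 0 \<tau>) has_field_derivative
    - (csc_series 0 (- 1) \<tau> / (of_real pi * \<i>)) * (csc_series 1 1 \<tau> - csc_series (- 1) 0 \<tau>)) (at \<tau>)"
  using DERIV_diff[OF DERIV_csc_series_2[OF assms] DERIV_csc_series_1[OF assms]]
  by (rule DERIV_cong) (rule halphen_difference)

lemma DERIV_csc_series_3_minus_1: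
  assumes "Im \<tau> > 0"
  shows "((\<lambda>\<tau>. csc_series 0 (- 1) \<tau> - csc_series (- 1) 0 \<tau>) has_field_derivative
    - (csc_series 1 1 \<tau> / (of_real pi * \<i>)) * (csc_series 0 (- 1) \<tau> - csc_series (- 1) 0 \<tau>)) (at \<tau>)"
  using DERIV_diff[OF DERIV_csc_series_3[OF assms] DERIV_csc_series_1[OF assms]]
  by (rule DERIV_cong) (rule trans[OF _ halphen_difference], simp only: ac_simps)

lemma csc_series_2_neq_1:
  assumes "Im \<tau> > 0"
  shows "csc_series 1 1 \<tau> - csc_series (- 1) 0 \<tau> \<noteq> 0"
proof (rule DERIV_eq_mult_imp_no_zero[where U = "{\<tau>. Im \<tau> > 0}" and w = "1 + \<i>"
      and f = "\<lambda>\<tau>. csc_series 1 1 \<tau> - csc_series (- 1) 0 \<tau>"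
      and g = "\<lambda>\<tau>. - (csc_series 0 (- 1) \<tau> / (of_real pi * \<i>))"])
  show "open {\<tau>. Im \<tau> > 0}" "convex {\<tau>. Im \<tau> > 0}"
    by (simp_all add: open_halfspace_Im_gt convex_halfspace_Im_gt)
  have "csc_series 0 (- 1) holomorphic_on {\<tau>. Im \<tau> > 0}"
    unfolding holomorphic_on_def field_differentiable_def
    using has_field_derivative_at_within[OF DERIV_csc_series_3] by blast
  then show "(\<lambda>\<tau>. - (csc_series 0 (- 1) \<tau> / (of_real pi * \<i>))) holomorphic_on {\<tau>. Im \<tau> > 0}"
    by (intro holomorphic_intros) auto
  show "((\<lambda>\<tau>. csc_series 1 1 \<tau> - csc_series (- 1) 0 \<tau>) has_field_derivative
    - (csc_series 0 (- 1) \<tau> / (of_real pi * \<i>)) * (csc_series 1 1 \<tau> - csc_series (- 1) 0 \<tau>)) (at \<tau>)"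
    if "\<tau> \<in> {\<tau>. Im \<tau> > 0}" for \<tau>
    using that by (intro DERIV_csc_series_2_minus_1) simp
  show "1 + \<i> \<in> {\<tau>. Im \<tau> > 0}" by simp
  show "csc_series 1 1 (1 + \<i>) - csc_series (- 1) 0 (1 + \<i>) \<noteq> 0"
    by (rule csc_series_2_minus_1_at_1_plus_i)
qed (use assms in simp)

section \<open>The formulas for t and for the powers of e2 - e1\<close>

lemma open_upper_half_plane: "open upper_half_plane"
  by (simp add: upper_half_plane_def open_halfspace_Im_gt)

text \<open>The logarithmic derivatives of A3 - A1 and A2 - A1 are -A2 / (pi i) and -A3 / (pi i).
  Hence that of t is (A3 - A2) / (pi i), and A3 - A2 = (A2 - A1)(t - 1).\<close>

lemma DERIV_t_fun:
  assumes "\<tau> \<in> upper_half_plane"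
  shows "(t_fun has_field_derivative
    (e2 \<tau> - e1 \<tau>) * t_fun \<tau> * (t_fun \<tau> - 1) / (complex_of_real pi * \<i>)) (at \<tau>)"
proof -
  have \<tau>: "Im \<tau> > 0" using assms by (simp add: upper_half_plane_def)
  define A1 A2 A3 where "A1 = csc_series (- 1) 0 \<tau>" and "A2 = csc_series 1 1 \<tau>"
    and "A3 = csc_series 0 (- 1) \<tau>"
  have t: "t_fun x = (csc_series 0 (- 1) x - csc_series (- 1) 0 x) / (csc_series 1 1 x - csc_series (- 1) 0 x)"
    if "x \<in> upper_half_plane" for x
    using that by (simp add: t_fun_def upper_half_plane_def
        e1_eq_csc_series e2_eq_csc_series e3_eq_csc_series)
  have nz: "A2 - A1 \<noteq> 0" unfolding A1_def A2_def by (rule csc_series_2_neq_1[OF \<tau>])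
  from DERIV_divide[OF DERIV_csc_series_3_minus_1[OF \<tau>] DERIV_csc_series_2_minus_1[OF \<tau>] csc_series_2_neq_1[OF \<tau>]]
  have "(t_fun has_field_derivative (- (A2 / (of_real pi * \<i>)) * (A3 - A1) * (A2 - A1)
      - (A3 - A1) * (- (A3 / (of_real pi * \<i>)) * (A2 - A1))) / ((A2 - A1) * (A2 - A1))) (at \<tau>)"
    unfolding A1_def A2_def A3_def
    by (rule has_field_derivative_transform_within_open[OF _ open_upper_half_plane assms]) (simp add: t)
  moreover have "(- (A2 / (of_real pi * \<i>)) * (A3 - A1) * (A2 - A1)
      - (A3 - A1) * (- (A3 / (of_real pi * \<i>)) * (A2 - A1))) / ((A2 - A1) * (A2 - A1))
    = (e2 \<tau> - e1 \<tau>) * t_fun \<tau> * (t_fun \<tau> - 1) / (of_real pi * \<i>)"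
  proof -
    have "t_fun \<tau> = (A3 - A1) / (A2 - A1)"
      using t[OF assms] by (simp add: A1_def A2_def A3_def)
    moreover have "t_fun \<tau> - 1 = (A3 - A2) / (A2 - A1)"
      unfolding calculation using nz by (simp add: field_simps)
    moreover have "e2 \<tau> - e1 \<tau> = A2 - A1"
      by (simp add: e1_eq_csc_series e2_eq_csc_series \<tau> A1_def A2_def)
    moreover have "(- (A2 / P) * B * D - B * (- (A3 / P) * D)) / (D * D) = D * (B / D) * ((A3 - A2) / D) / P"
      if "D \<noteq> 0" "P \<noteq> 0" for B D P :: complex
      using that by (simp add: field_simps)
    ultimately show ?thesis using nz by simp
  qed
  ultimately show ?thesis by simp
qed

text \<open>The chain rule for exp L and the linear equation for A2 - A1 = exp L give two values of
  the same derivative, and exp L can be cancelled. The result is the same for every branch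
  L.\<close>

lemma DERIV_holomorphic_log:
  assumes L: "holomorphic_log_on L (\<lambda>\<tau>. e2 \<tau> - e1 \<tau>) upper_half_plane"
    and "\<tau> \<in> upper_half_plane"
  shows "(L has_field_derivative - (2 * eta1 \<tau> + e3 \<tau>) / (of_real pi * \<i>)) (at \<tau>)"
proof -
  have \<tau>: "Im \<tau> > 0" using assms by (simp add: upper_half_plane_def)
  have exp_L: "exp (L x) = csc_series 1 1 x - csc_series (- 1) 0 x" if "x \<in> upper_half_plane" for x
    using L that by (simp add: holomorphic_log_on_def upper_half_plane_def
        e1_eq_csc_series e2_eq_csc_series)
  have A3: "csc_series 0 (- 1) \<tau> = 2 * eta1 \<tau> + e3 \<tau>" by (simp add: e3_eq_csc_series \<tau>)
  have dL: "(L has_field_derivative deriv L \<tau>) (at \<tau>)"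
    using L assms(2) open_upper_half_plane by (auto simp: holomorphic_log_on_def intro: holomorphic_derivI)
  have "((\<lambda>x. exp (L x)) has_field_derivative exp (L \<tau>) * deriv L \<tau>) (at \<tau>)"
    by (rule DERIV_chain2[OF DERIV_exp dL])
  moreover have "((\<lambda>x. exp (L x)) has_field_derivative
      - (csc_series 0 (- 1) \<tau> / (of_real pi * \<i>)) * exp (L \<tau>)) (at \<tau>)"
    using DERIV_csc_series_2_minus_1[OF \<tau>] unfolding exp_L[OF assms(2)]
    by (rule has_field_derivative_transform_within_open[OF _ open_upper_half_plane assms(2)])
      (simp add: exp_L)
  ultimately have "exp (L \<tau>) * deriv L \<tau> = - (csc_series 0 (- 1) \<tau> / (of_real pi * \<i>)) * exp (L \<tau>)"
    by (rule DERIV_unique)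
  then have "exp (L \<tau>) * deriv L \<tau> = exp (L \<tau>) * (- csc_series 0 (- 1) \<tau> / (of_real pi * \<i>))"
    by (simp add: mult.commute)
  then have "deriv L \<tau> = - (2 * eta1 \<tau> + e3 \<tau>) / (of_real pi * \<i>)"
    by (simp only: mult_left_cancel[OF exp_not_eq_zero] A3)
  with dL show ?thesis by simp
qed

lemma DERIV_branch_power:
  assumes "holomorphic_log_on L (\<lambda>\<tau>. e2 \<tau> - e1 \<tau>) upper_half_plane" "\<tau> \<in> upper_half_plane"
  shows "(branch_power L \<alpha> has_field_derivative
    - (\<alpha> * (2 * eta1 \<tau> + e3 \<tau>) * branch_power L \<alpha> \<tau>) / (complex_of_real pi * \<i>)) (at \<tau>)"
proof -
  have eq: "E * (a * (- s / P)) = - (a * s * E) / P" for E a s P :: complex by simp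
  show ?thesis
    unfolding branch_power_def[abs_def]
    by (rule DERIV_cong[OF DERIV_chain2[OF DERIV_exp DERIV_cmult[OF DERIV_holomorphic_log[OF assms]]]])
      (rule eq)
qed

theorem propositionA1:
  shows "(\<forall>\<tau>\<in>upper_half_plane.
            (t_fun has_field_derivative
               (e2 \<tau> - e1 \<tau>) * t_fun \<tau> * (t_fun \<tau> - 1) / (complex_of_real pi * \<i>)) (at \<tau>)) \<and>
         (\<forall>L. holomorphic_log_on L (\<lambda>\<tau>. e2 \<tau> - e1 \<tau>) upper_half_plane \<longrightarrow>
            (\<forall>\<tau>\<in>upper_half_plane.
               ((\<lambda>\<tau>. 1 / branch_power L (1 / 2) \<tau>) has_field_derivative
                  (eta1 \<tau> + e3 \<tau> / 2) / (complex_of_real pi * \<i> * branch_power L (1 / 2) \<tau>)) (at \<tau>)) \<and>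
            (\<forall>\<alpha>::complex. \<forall>\<tau>\<in>upper_half_plane.
               (branch_power L \<alpha> has_field_derivative
                  - (\<alpha> * (2 * eta1 \<tau> + e3 \<tau>) * branch_power L \<alpha> \<tau>) / (complex_of_real pi * \<i>)) (at \<tau>)))"
proof (intro conjI allI impI ballI)
  fix L \<tau>
  assume L: "holomorphic_log_on L (\<lambda>\<tau>. e2 \<tau> - e1 \<tau>) upper_half_plane" "\<tau> \<in> upper_half_plane"
  \<comment> \<open>The reciprocal square root is the power with exponent -1/2 of the same branch,
    so its formula is the case alpha = -1/2 of the general one.\<close>
  have inv: "1 / branch_power L (1 / 2) x = branch_power L (- 1 / 2) x" for x
  proof -
    have "- 1 / 2 * L x = - (1 / 2 * L x)" by simp
    then show ?thesis unfolding branch_power_def by (simp only: exp_minus inverse_eq_divide)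
  qed
  have "branch_power L (- 1 / 2) \<tau> = 1 / branch_power L (1 / 2) \<tau>" by (simp only: inv)
  then have "- (- 1 / 2 * (2 * eta1 \<tau> + e3 \<tau>) * branch_power L (- 1 / 2) \<tau>) / (complex_of_real pi * \<i>)
      = (eta1 \<tau> + e3 \<tau> / 2) / (complex_of_real pi * \<i> * branch_power L (1 / 2) \<tau>)"
    by (simp add: field_simps)
  with DERIV_branch_power[OF L, of "- 1 / 2"]
  show "((\<lambda>\<tau>. 1 / branch_power L (1 / 2) \<tau>) has_field_derivative
      (eta1 \<tau> + e3 \<tau> / 2) / (complex_of_real pi * \<i> * branch_power L (1 / 2) \<tau>)) (at \<tau>)"
    unfolding inv by simp
qed (fact DERIV_t_fun DERIV_branch_power)+

end
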